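(* Let $n\ge3$, let $\Delta$ be a maximal simplex of $\Gamma_{2,n}$ with vertex set $\{\epsilon_I: I\in E\}$, let $G$ be the graph on $[n]$ with edge set $E$, and let $C$ be the unique cycle of $G$. If $G$ is a triangle (so $n=3$), then $\Delta=\Delta_{2,3}$ is the unique maximal simplex of $\Gamma_{2,3}$ and has degree $0$. If $G$ is not a triangle, $|C|=3$ and $G$ has two vertices of degree two, then $\Delta$ has degree $2$. In all other cases, $\Delta$ has degree $|C|$.
   Context: For $I\subseteq[n]$, $\epsilon_I\in\mathbb{R}^n$ is its 0/1 indicator vector; $\Delta_{2,n}=\mathrm{conv}\{\epsilon_I:|I|=2\}$. For 2-subsets $I,J$ let $(a_1,a_2,a_3,a_4)$ be the nondecreasing ordering of the multiset union, $U(I,J)=\{a_1,a_3\}$, $V(I,J)=\{a_2,a_4\}$; $(I,J)$ is sorted if $I=U(I,J)$, $J=V(I,J)$, and an ordered collection is sorted if each pair $(I_i,I_j)$, $i<j$, is sorted. $\Gamma_{2,n}$ is the triangulation of $\Delta_{2,n}$ whose maximal simplices are $\mathrm{conv}\{\epsilon_{I_1},\dots,\epsilon_{I_n}\}$ for maximal sorted collections $(I_1,\dots,I_n)$. Identify 2-subsets with edges of a graph on $[n]$ whose vertices are drawn on a circle, labelled clockwise in increasing order, with edges drawn as chords; a thrackle is such a graph in which every two edges intersect (sharing an endpoint counts). The graphs $G$ arising from maximal simplices are exactly the thrackles with $n$ edges; each such $G$ contains a unique cycle $C$, which has odd length and pairwise crossing edges, and every other edge of $G$ joins a vertex not on $C$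 to the unique vertex of $C$ opposite to it (so that the edge crosses all edges of $C$). The degree of a maximal simplex $\Delta$ is the number of other maximal simplices of $\Gamma_{2,n}$ sharing a facet with $\Delta$. *)

theory Defs
  imports "HOL-Analysis.Analysis" "HOL-Library.Multiset"
begin

text \<open>
  The ground set \<open>[n]\<close> is the universe of a finite linearly ordered index type \<open>'n\<close>, so that
  \<open>n = CARD('n)\<close> and \<open>\<real>\<^sup>n\<close> is \<open>real ^ 'n\<close>.
\<close>

definition eps :: "'n set \<Rightarrow> real ^ 'n::finite" where
  "eps I = (\<chi> i. indicator I i)"

definition hypersimplex2 :: "(real ^ 'n::finite) set" where
  "hypersimplex2 = convex hull {eps I | I. card I = 2}"

definition merged :: "'n::linorder set \<Rightarrow> 'n set \<Rightarrow> 'n list" where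
  "merged I J = sorted_list_of_multiset (mset_set I + mset_set J)"

definition sort_U :: "'n::linorder set \<Rightarrow> 'n set \<Rightarrow> 'n set" where
  "sort_U I J = {merged I J ! 0, merged I J ! 2}"

definition sort_V :: "'n::linorder set \<Rightarrow> 'n set \<Rightarrow> 'n set" where
  "sort_V I J = {merged I J ! 1, merged I J ! 3}"

definition sorted_pair :: "'n::linorder set \<Rightarrow> 'n set \<Rightarrow> bool" where
  "sorted_pair I J \<longleftrightarrow> I = sort_U I J \<and> J = sort_V I J"

text \<open>
  Collections are repetition-free; distinctness has to be demanded because \<open>(I, I)\<close> is a sorted pair.
\<close>

definition sorted_collection :: "'n::linorder set list \<Rightarrow> bool" where
  "sorted_collection Is \<longleftrightarrow>
     distinct Is \<and> (\<forall>I \<in> set Is. card I = 2) \<and> sorted_wrt sorted_pair Is"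

definition maximal_sorted_collection :: "'n::linorder set list \<Rightarrow> bool" where
  "maximal_sorted_collection Is \<longleftrightarrow>
     sorted_collection Is \<and> (\<nexists>Js. sorted_collection Js \<and> set Is \<subset> set Js)"

definition Gamma2_maximal_simplices :: "(real ^ 'n::{finite,linorder}) set set" where
  "Gamma2_maximal_simplices =
     {convex hull (eps ` set Is) | Is. maximal_sorted_collection Is \<and> length Is = CARD('n)}"

definition simplex_degree :: "(real ^ 'n::{finite,linorder}) set \<Rightarrow> nat" where
  "simplex_degree D =
     card {D' \<in> Gamma2_maximal_simplices. D' \<noteq> D \<and> (\<exists>F. F facet_of D \<and> F facet_of D')}"

text \<open>
  A graph on \<open>[n]\<close> is given by its edge set. A cycle is likewise represented by its set of edges,
  which makes it independent of starting point and orientation; its length is the number of edges.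
\<close>

definition graph_cycle :: "'n set set \<Rightarrow> 'n set set \<Rightarrow> bool" where
  "graph_cycle E C \<longleftrightarrow> C \<subseteq> E \<and>
     (\<exists>vs. distinct vs \<and> length vs \<ge> 3 \<and>
           C = {{vs ! i, vs ! (Suc i mod length vs)} | i. i < length vs})"

definition unique_cycle :: "'n set set \<Rightarrow> 'n set set" where
  "unique_cycle E = (THE C. graph_cycle E C)"

definition is_triangle :: "'n set set \<Rightarrow> bool" where
  "is_triangle E \<longleftrightarrow>
     (\<exists>a b c. a \<noteq> b \<and> a \<noteq> c \<and> b \<noteq> c \<and> E = {{a, b}, {b, c}, {a, c}})"

definition vertex_degree :: "'n set set \<Rightarrow> 'n \<Rightarrow> nat" where
  "vertex_degree E v = card {e \<in> E. v \<in> e}"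

end

theory Submission imports Defs begin

text \<open>
  Sort the \<open>n\<close> edges of a maximal thrackle and write the \<open>k\<close>-th as \<open>a k < b k\<close> with labels in
  \<open>{0..<n}\<close>. Sortedness says \<open>a 0 \<le> \<dots> \<le> a (n - 1) \<le> b 0 \<le> \<dots> \<le> b (n - 1)\<close>, and since the sums
  \<open>a k + b k\<close> increase strictly, having \<open>n\<close> edges forces every inequality to be tight: the edges are
  the nodes of a lattice path of unit steps from \<open>(0, m)\<close> to \<open>(m, n - 1)\<close> that avoids \<open>(m, m)\<close>.
  Each node that is not a corner of the path has a leaf vertex, and consecutive corners share a
  vertex, so the unique cycle consists of the corners. Removing a node leaves room for
  another one only at a corner, which is cut off the other way; this fails only if the new node
  would leave the region \<open>a < b\<close>, and then there are just three corners, two of the three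
  runs between them having length one.
\<close>

section \<open>Labels as natural numbers: the index type is order-isomorphic to
  \<open>{..<CARD('n)}\<close>\<close>

definition rk :: "'n::{finite,linorder} \<Rightarrow> nat" where
  "rk x = card {..<x}"

definition ix :: "nat \<Rightarrow> 'n::{finite,linorder}" where
  "ix = inv rk"

lemma rk_strict_mono: "x < y \<Longrightarrow> rk x < rk y"
  unfolding rk_def by (intro psubset_card_mono) auto

lemma rk_less_iff [simp]: "rk x < rk y \<longleftrightarrow> x < y"
  by (metis rk_strict_mono less_asym linorder_neqE)

lemma rk_le_iff [simp]: "rk x \<le> rk y \<longleftrightarrow> x \<le> y"
  by (metis not_less rk_less_iff)

lemma rk_eq_iff [simp]: "rk x = rk y \<longleftrightarrow> x = y"
  by (metis order_antisym order_refl rk_le_iff)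

lemma rk_less_card: "rk (x :: 'n::{finite,linorder}) < CARD('n)"
  unfolding rk_def by (intro psubset_card_mono) auto

lemma ix_rk [simp]: "ix (rk x) = x"
  unfolding ix_def by (intro inv_f_f injI) simp

lemma range_rk: "range (rk :: 'n::{finite,linorder} \<Rightarrow> nat) = {..<CARD('n)}"
proof (rule card_subset_eq)
  show "range (rk :: 'n \<Rightarrow> nat) \<subseteq> {..<CARD('n)}"
    using rk_less_card by auto
  show "card (range (rk :: 'n \<Rightarrow> nat)) = card {..<CARD('n)}"
    by (simp add: card_image inj_def)
qed simp

lemma rk_ix: "k < CARD('n) \<Longrightarrow> rk (ix k :: 'n::{finite,linorder}) = k"
  unfolding ix_def by (rule f_inv_into_f) (simp add: range_rk)

lemma inj_on_ix: "inj_on (ix :: nat \<Rightarrow> 'n::{finite,linorder}) {..<CARD('n)}"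
  by (rule inj_on_inverseI[where g = rk]) (simp add: rk_ix)

lemma ix_eq_iff:
  "i < CARD('n) \<Longrightarrow> j < CARD('n) \<Longrightarrow> (ix i :: 'n::{finite,linorder}) = ix j \<longleftrightarrow> i = j"
  by (metis rk_ix)

section \<open>Edges as pairs of labels, and sortedness as interlacing\<close>

definition lo :: "'n::{finite,linorder} set \<Rightarrow> nat" where
  "lo I = rk (Min I)"

definition hi :: "'n::{finite,linorder} set \<Rightarrow> nat" where
  "hi I = rk (Max I)"

lemma card_2_orderedE:
  fixes I :: "'a::linorder set"
  assumes "card I = 2"
  obtains x y where "x < y" "I = {x, y}"
  using assms by (metis card_2_iff insert_commute linorder_neqE)

lemma lo_hi_insert: "x < y \<Longrightarrow> lo {x, y} = rk x" "x < y \<Longrightarrow> hi {x, y} = rk y"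
  by (auto simp: lo_def hi_def)

lemma
  fixes I :: "'n::{finite,linorder} set"
  assumes "card I = 2"
  shows lo_less_hi: "lo I < hi I"
    and hi_less_card: "hi I < CARD('n)"
    and edge_lo_hi: "{ix (lo I), ix (hi I)} = I"
  by (rule card_2_orderedE[OF assms]; simp add: lo_hi_insert rk_less_card)+

lemma
  assumes "i < j" "j < CARD('n)"
  shows card_edge: "card {ix i, ix j :: 'n::{finite,linorder}} = 2"
    and lo_edge: "lo {ix i, ix j :: 'n} = i"
    and hi_edge: "hi {ix i, ix j :: 'n} = j"
proof -
  have "(ix i :: 'n) < ix j"
    using assms by (subst rk_less_iff[symmetric]) (simp add: rk_ix)
  then show "card {ix i, ix j :: 'n} = 2" "lo {ix i, ix j :: 'n} = i" "hi {ix i, ix j :: 'n} = j"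
    using assms by (auto simp: lo_hi_insert rk_ix)
qed

text \<open>The chords meet, shared endpoints included, with \<open>I\<close> taking the first and
  third place of the merged list. Two chords meet iff this holds in one of the two orders.\<close>

definition interlaced :: "'n::{finite,linorder} set \<Rightarrow> 'n set \<Rightarrow> bool" where
  "interlaced I J \<longleftrightarrow> lo I \<le> lo J \<and> lo J \<le> hi I \<and> hi I \<le> hi J"

lemma sorted_pair_iff_interlaced:
  fixes I J :: "'n::{finite,linorder} set"
  assumes "card I = 2" "card J = 2"
  shows "sorted_pair I J \<longleftrightarrow> interlaced I J"
proof -
  obtain p q where I: "p < q" "I = {p, q}" using assms(1) by (rule card_2_orderedE)
  obtain r s where J: "r < s" "J = {r, s}" using assms(2) by (rule card_2_orderedE)
  have mset: "mset_set I + mset_set J = mset [p, r, q, s]"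
    using I J by simp
  show ?thesis
  proof
    assume "interlaced I J"
    then have "p \<le> r" "r \<le> q" "q \<le> s"
      using I J by (auto simp: interlaced_def lo_hi_insert)
    then have "merged I J = [p, r, q, s]"
      unfolding merged_def mset sorted_list_of_multiset_mset by (intro sort_key_id_if_sorted) auto
    then show "sorted_pair I J"
      using I J by (simp add: sorted_pair_def sort_U_def sort_V_def)
  next
    assume *: "sorted_pair I J"
    define xs where "xs = merged I J"
    have xs: "sorted xs" "length xs = 4"
      unfolding xs_def merged_def mset sorted_list_of_multiset_mset
      by (rule sorted_sort, simp only: length_sort list.size)
    have IJ: "I = {xs ! 0, xs ! 2}" "J = {xs ! 1, xs ! 3}"
      using * unfolding sorted_pair_def sort_U_def sort_V_def xs_def by auto
    have le: "xs ! 0 \<le> xs ! 1" "xs ! 1 \<le> xs ! 2" "xs ! 2 \<le> xs ! 3"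
      using xs by (auto intro: sorted_nth_mono)
    \<comment> \<open>Equal entries would collapse an edge to a singleton. Strictness is what
      identifies the entries with \<open>lo\<close> and \<open>hi\<close>.\<close>
    have "xs ! 0 \<noteq> xs ! 2" "xs ! 1 \<noteq> xs ! 3"
      using assms IJ by auto
    then have "xs ! 0 < xs ! 2" "xs ! 1 < xs ! 3"
      using le by force+
    then show "interlaced I J"
      using le by (simp add: IJ interlaced_def lo_hi_insert)
  qed
qed

section \<open>Maximal thrackles and maximal sorted collections\<close>

text \<open>The order-free counterpart of a maximal sorted collection. Maximality is encoded as
  attaining the bound of \<open>length_sorted_collection_le\<close>.\<close>

definition max_thrackle :: "'n::{finite,linorder} set set \<Rightarrow> bool" where
  "max_thrackle E \<longleftrightarrow> (\<forall>I \<in> E. card I = 2) \<and>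
     (\<forall>I \<in> E. \<forall>J \<in> E. interlaced I J \<or> interlaced J I) \<and> card E = CARD('n)"

lemma interlaced_refl: "card I = 2 \<Longrightarrow> interlaced I I"
  using lo_less_hi[of I] by (simp add: interlaced_def)

text \<open>Interlacing makes both coordinates weakly increase, so sorting by \<open>lo + hi\<close>
  puts every pair in the right order; interlaced edges with equal sums coincide.\<close>

lemma ex_sorted_collection:
  fixes E :: "'n::{finite,linorder} set set"
  assumes card2: "\<forall>I \<in> E. card I = 2"
    and il: "\<forall>I \<in> E. \<forall>J \<in> E. interlaced I J \<or> interlaced J I"
  obtains Is where "set Is = E" "sorted_collection Is"
proof -
  obtain xs where xs: "set xs = E" "distinct xs"
    using finite_distinct_list[of E] by auto
  define f where "f I = lo I + hi I" for I :: "'n set"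
  define ys where "ys = sort_key f xs"
  have ys: "set ys = E" "distinct ys" "sorted (map f ys)"
    using xs by (auto simp: ys_def)
  have "sorted_wrt (\<lambda>I J. f I \<le> f J) ys"
    using ys(3) by (simp add: sorted_map)
  then have "sorted_wrt sorted_pair ys"
  proof (rule sorted_wrt_mono_rel[rotated])
    fix I J assume IJ: "I \<in> set ys" "J \<in> set ys" "f I \<le> f J"
    then have "interlaced I J \<or> interlaced J I" "card I = 2" "card J = 2"
      using card2 il ys(1) by auto
    then show "sorted_pair I J"
      using IJ(3) lo_less_hi[of I] by (auto simp: sorted_pair_iff_interlaced interlaced_def f_def)
  qed
  then have "sorted_collection ys"
    using ys card2 by (simp add: sorted_collection_def)
  with ys that show thesis by blast
qed

lemma sorted_collection_interlaced:
  assumes "sorted_collection Is" "i < j" "j < length Is"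
  shows "interlaced (Is ! i) (Is ! j)"
proof -
  have "sorted_pair (Is ! i) (Is ! j)"
    using assms by (simp add: sorted_collection_def sorted_wrt_iff_nth_less)
  moreover have "card (Is ! i) = 2" "card (Is ! j) = 2"
    using assms by (simp_all add: sorted_collection_def)
  ultimately show ?thesis by (simp add: sorted_pair_iff_interlaced)
qed

text \<open>The coordinate sum \<open>lo + hi\<close> strictly increases along a sorted collection and grows by at
  most \<open>n - 1\<close> in total, because \<open>lo\<close> of the last edge is at most \<open>hi\<close> of the first.\<close>

lemma sorted_collection_sum_le:
  assumes "sorted_collection Is" "i \<le> j" "j < length Is"
  shows "lo (Is ! i) + hi (Is ! i) + (j - i) \<le> lo (Is ! j) + hi (Is ! j)"
  using assms(2,3)
proof (induction j rule: dec_induct)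
  case (step j)
  have il: "interlaced (Is ! j) (Is ! Suc j)"
    using assms(1) step by (intro sorted_collection_interlaced) auto
  have "Is ! j \<noteq> Is ! Suc j"
    using assms(1) step by (auto simp: sorted_collection_def nth_eq_iff_index_eq)
  moreover have "card (Is ! j) = 2" "card (Is ! Suc j) = 2"
    using assms(1) step by (simp_all add: sorted_collection_def)
  ultimately have "lo (Is ! j) \<noteq> lo (Is ! Suc j) \<or> hi (Is ! j) \<noteq> hi (Is ! Suc j)"
    by (metis edge_lo_hi)
  then show ?case
    using step il by (auto simp: interlaced_def)
qed simp

lemma length_sorted_collection_le:
  fixes Is :: "'n::{finite,linorder} set list"
  assumes "sorted_collection Is"
  shows "length Is \<le> CARD('n)"
proof (cases "Is = []")
  case False
  define l where "l = length Is - 1"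
  have l: "l < length Is" "0 < length Is" using False by (auto simp: l_def)
  have card2: "card (Is ! 0) = 2" "card (Is ! l) = 2"
    using assms l by (simp_all add: sorted_collection_def)
  have "lo (Is ! l) \<le> hi (Is ! 0)"
  proof (cases "l = 0")
    case True
    then show ?thesis using lo_less_hi[OF card2(1)] by simp
  next
    case False
    then show ?thesis
      using sorted_collection_interlaced[OF assms, of 0 l] l by (simp add: interlaced_def)
  qed
  then show ?thesis
    using sorted_collection_sum_le[OF assms, of 0 l] l hi_less_card[OF card2(2)] by (simp add: l_def)
qed simp

text \<open>A strictly larger sorted collection would have more than \<open>CARD('n)\<close>
  members, so the number of edges alone yields maximality.\<close>

lemma maximal_sorted_collection_iff_max_thrackle:
  fixes E :: "'n::{finite,linorder} set set"
  shows "(\<exists>Is. maximal_sorted_collection Is \<and> length Is = CARD('n) \<and> set Is = E) \<longleftrightarrow> max_thrackle E"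
proof
  assume "\<exists>Is. maximal_sorted_collection Is \<and> length Is = CARD('n) \<and> set Is = E"
  then obtain Is where Is: "sorted_collection Is" "length Is = CARD('n)" "set Is = E"
    unfolding maximal_sorted_collection_def by blast
  have card2: "\<forall>I \<in> E. card I = 2" and "distinct Is"
    using Is unfolding sorted_collection_def by simp_all
  have "interlaced I J \<or> interlaced J I" if "I \<in> E" "J \<in> E" for I J
  proof -
    obtain i where i: "i < length Is" "Is ! i = I"
      using \<open>I \<in> E\<close> Is(3) by (auto simp: in_set_conv_nth)
    obtain j where j: "j < length Is" "Is ! j = J"
      using \<open>J \<in> E\<close> Is(3) by (auto simp: in_set_conv_nth)
    have "card I = 2" using that card2 by blast
    then show ?thesis
      using sorted_collection_interlaced[OF Is(1), of i j] sorted_collection_interlaced[OF Is(1), of j i]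
        interlaced_refl[of I] i j
      by (cases i j rule: linorder_cases) simp_all
  qed
  then show "max_thrackle E"
    using Is card2 distinct_card[OF \<open>distinct Is\<close>] unfolding max_thrackle_def by simp
next
  assume E: "max_thrackle E"
  then obtain Is where Is: "set Is = E" "sorted_collection Is"
    using ex_sorted_collection[of E] unfolding max_thrackle_def by blast
  have "\<not> set Is \<subset> set Js" if "sorted_collection Js" for Js
  proof
    assume "set Is \<subset> set Js"
    then have "card E < card (set Js)"
      using Is(1) by (auto intro: psubset_card_mono)
    also have "\<dots> \<le> CARD('n)"
      using length_sorted_collection_le[OF that] card_length[of Js] by linarith
    finally show False using E by (simp add: max_thrackle_def)
  qed
  moreover have "length Is = CARD('n)"
    using Is E distinct_card[of Is] by (simp add: max_thrackle_def sorted_collection_def)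
  ultimately show "\<exists>Is. maximal_sorted_collection Is \<and> length Is = CARD('n) \<and> set Is = E"
    using Is by (auto simp: maximal_sorted_collection_def)
qed

section \<open>The lattice path of a maximal thrackle\<close>

text \<open>Node \<open>k\<close> is the pair of labels of the \<open>k\<close>-th edge. The double
  role of \<open>m\<close> is the tight case of the inequality between the smaller label of the last
  edge and the larger label of the first.\<close>

locale staircase =
  fixes n m :: nat and a b :: "nat \<Rightarrow> nat"
  assumes n3: "3 \<le> n"
    and a_first: "a 0 = 0" and b_first: "b 0 = m"
    and a_last: "a (n - Suc 0) = m" and b_last: "b (n - Suc 0) = n - Suc 0"
    and step: "Suc k < n \<Longrightarrow>
      a (Suc k) = Suc (a k) \<and> b (Suc k) = b k \<or> a (Suc k) = a k \<and> b (Suc k) = Suc (b k)"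
    and a_less_b: "k < n \<Longrightarrow> a k < b k"

lemma max_thrackle_staircase:
  fixes E :: "'n::{finite,linorder} set set"
  assumes E: "max_thrackle E" and n3: "3 \<le> CARD('n)"
  obtains m a b where "staircase CARD('n) m a b" "E = (\<lambda>k. {ix (a k), ix (b k)}) ` {..<CARD('n)}"
proof -
  define n where n: "n = CARD('n)"
  obtain Is where Is: "set Is = E" "sorted_collection Is" "length Is = n"
    using E n unfolding maximal_sorted_collection_iff_max_thrackle[symmetric]
    by (auto simp: maximal_sorted_collection_def)
  define a where "a k = lo (Is ! k)" for k
  define b where "b k = hi (Is ! k)" for k
  have card2: "card (Is ! k) = 2" if "k < n" for k
    using that Is nth_mem[of k Is] unfolding sorted_collection_def by metis
  have ab: "a k < b k" "b k < n" if "k < n" for k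
    using lo_less_hi[OF card2[OF that]] hi_less_card[OF card2[OF that]] n by (simp_all add: a_def b_def)
  have il: "a i \<le> a j \<and> a j \<le> b i \<and> b i \<le> b j" if "i < j" "j < n" for i j
    using sorted_collection_interlaced[OF Is(2)] that Is(3) by (simp add: interlaced_def a_def b_def)
  have sum: "a i + b i + (j - i) \<le> a j + b j" if "i \<le> j" "j < n" for i j
    using sorted_collection_sum_le[OF Is(2)] that Is(3) by (simp add: a_def b_def)
  obtain l where l: "n = Suc l" "2 \<le> l"
    using n3 n by (metis Suc_le_D Suc_le_mono numeral_3_eq_3 numeral_2_eq_2)
  \<comment> \<open>Chaining these gives \<open>a 0 + b 0 + l \<le> b 0 + l\<close>, so all of them
    are equalities: \<open>a 0 = 0\<close>, \<open>a l = b 0\<close> and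
    \<open>b l = l\<close>.\<close>
  have tot: "a l \<le> b 0" "a 0 + b 0 + l \<le> a l + b l" "b l \<le> l"
    using il[of 0 l] sum[of 0 l] ab[of l] l by linarith+
  have "staircase n (b 0) a b"
  proof
    fix k assume k: "Suc k < n"
    \<comment> \<open>The growth before \<open>k\<close> and after \<open>Suc k\<close> uses up all
      but one of the total \<open>l\<close>, so the sum rises by exactly one in between.\<close>
    have "a 0 + b 0 + k \<le> a k + b k" "a (Suc k) + b (Suc k) + (l - Suc k) \<le> a l + b l"
      using sum[of 0 k] sum[of "Suc k" l] k l by linarith+
    then show "a (Suc k) = Suc (a k) \<and> b (Suc k) = b k \<or> a (Suc k) = a k \<and> b (Suc k) = Suc (b k)"
      using tot il[of k "Suc k"] sum[of k "Suc k"] k l by linarith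
  next
    show "a 0 = 0" "b 0 = b 0" "a (n - Suc 0) = b 0" "b (n - Suc 0) = n - Suc 0"
      using tot l by simp_all
  qed (use l ab in simp_all)
  moreover have "E = (\<lambda>k. {ix (a k), ix (b k)}) ` {..<n}"
  proof -
    have "E = (!) Is ` {..<n}"
      using Is by (auto simp: set_conv_nth)
    also have "\<dots> = (\<lambda>k. {ix (a k), ix (b k)}) ` {..<n}"
      using edge_lo_hi[OF card2] by (intro image_cong) (auto simp: a_def b_def)
    finally show ?thesis .
  qed
  ultimately show thesis using that n by blast
qed

section \<open>Steps, corners and vertices of the path\<close>

context staircase
begin

text \<open>Every unit step adds one, so a node determines its position, and paths with the same
  \<open>m\<close> can be compared position by position.\<close>

lemma sum_eq: "k < n \<Longrightarrow> a k + b k = m + k"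
proof (induction k)
  case (Suc k)
  then show ?case using step[of k] by auto
qed (simp add: a_first b_first)

lemma
  assumes "i \<le> j" "j < n"
  shows a_mono: "a i \<le> a j" and b_mono: "b i \<le> b j"
  using assms
proof (induction j rule: dec_induct)
  case (step j)
  { case 1 then show ?case using step.IH staircase.step[OF staircase_axioms, of j] by auto }
  { case 2 then show ?case using step.IH staircase.step[OF staircase_axioms, of j] by auto }
qed simp_all

lemma
  assumes "k < n"
  shows a_le: "a k \<le> m" and b_ge: "m \<le> b k" and b_le: "b k \<le> n - Suc 0"
  using a_mono[of k "n - Suc 0"] b_mono[of k "n - Suc 0"] b_mono[of 0 k] assms
  by (simp_all add: a_last b_first b_last)

lemma m_pos: "0 < m"
  using a_less_b[of 0] n3 by (simp add: a_first b_first)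

lemma m_less: "Suc m < n"
  using a_less_b[of "n - Suc 0"] n3 by (simp add: a_last b_last)

lemma n_SucSuc:
  obtains q where "n = Suc (Suc q)"
  using that[of "n - 2"] n3 by simp

text \<open>The path is read as a word in the two kinds of steps, entered by an \<open>a\<close>-step at position \<open>0\<close>
  and left by a \<open>b\<close>-step at position \<open>n\<close>: one turn around the circle swaps the roles of \<open>a\<close> and \<open>b\<close>.\<close>

definition a_step :: "nat \<Rightarrow> bool" where
  "a_step k \<longleftrightarrow> k = 0 \<or> (k < n \<and> a (k - 1) < a k)"

text \<open>The fictitious outer steps allow the end nodes to be corners: node \<open>0\<close> if
  the path starts with a \<open>b\<close>-step, node \<open>n - 1\<close> if it ends with an
  \<open>a\<close>-step.\<close>

definition corner :: "nat \<Rightarrow> bool" where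
  "corner k \<longleftrightarrow> k < n \<and> a_step k \<noteq> a_step (Suc k)"

lemma a_step_0: "a_step 0"
  by (simp add: a_step_def)

lemma not_a_step_n: "n \<le> k \<Longrightarrow> \<not> a_step k"
  using n3 by (simp add: a_step_def)

lemma a_step_SucD: "a_step (Suc k) \<Longrightarrow> Suc k < n \<and> a (Suc k) = Suc (a k) \<and> b (Suc k) = b k"
  using step[of k] by (auto simp: a_step_def)

lemma b_step_SucD: "\<not> a_step (Suc k) \<Longrightarrow> Suc k < n \<Longrightarrow> a (Suc k) = a k \<and> b (Suc k) = Suc (b k)"
  using step[of k] by (auto simp: a_step_def)

lemma a_step_const:
  assumes "\<And>j. i < j \<Longrightarrow> j < k \<Longrightarrow> \<not> corner j" "i < j" "j \<le> k" "k \<le> n"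
  shows "a_step j = a_step (Suc i)"
proof -
  have "Suc i \<le> j" using assms(2) by simp
  then show ?thesis using assms(3)
  proof (induction j rule: dec_induct)
    case (step j)
    then have "\<not> corner j" "j < n" using assms(1)[of j] assms(4) by auto
    then show ?case using step by (auto simp: corner_def)
  qed simp
qed

lemma a_run:
  assumes "i \<le> k" "k < n" "\<And>j. i < j \<Longrightarrow> j \<le> k \<Longrightarrow> a_step j"
  shows "a k = a i + (k - i) \<and> b k = b i"
  using assms
proof (induction k rule: dec_induct)
  case (step k)
  then show ?case using a_step_SucD[of k] by auto
qed simp

lemma b_run:
  assumes "i \<le> k" "k < n" "\<And>j. i < j \<Longrightarrow> j \<le> k \<Longrightarrow> \<not> a_step j"
  shows "a k = a i \<and> b k = b i + (k - i)"
  using assms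
proof (induction k rule: dec_induct)
  case (step k)
  then show ?case using b_step_SucD[of k] by auto
qed simp

text \<open>The vertex whose row or column is entered at position \<open>k\<close>.\<close>

definition vertex :: "nat \<Rightarrow> nat" where
  "vertex k = (if a_step k then a k else b k)"

lemma a_step_less: "a_step k \<Longrightarrow> j < k \<Longrightarrow> a j < a k"
  using a_step_SucD[of "k - 1"] a_mono[of j "k - 1"] by (cases k) auto

lemma b_step_less: "\<not> a_step k \<Longrightarrow> j < k \<Longrightarrow> k < n \<Longrightarrow> b j < b k"
  using b_step_SucD[of "k - 1"] b_mono[of j "k - 1"] by (cases k) auto

lemma b_step_gt: "\<not> a_step k \<Longrightarrow> k < n \<Longrightarrow> m < b k"
  using b_step_less[of k 0] a_step_0 by (cases k) (auto simp: b_first)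

text \<open>Labels entered by \<open>a\<close>-steps are at most \<open>m\<close> and those entered
  by \<open>b\<close>-steps exceed \<open>m\<close>; within each kind they increase
  strictly.\<close>

lemma vertex_neq:
  assumes "i < j" "j < n"
  shows "vertex i \<noteq> vertex j"
  using assms a_step_less[of j i] b_step_less[of j i] b_step_gt[of i] b_step_gt[of j] a_le[of i] a_le[of j]
  by (auto simp: vertex_def)

lemma inj_on_vertex: "inj_on vertex {..<n}"
  by (rule inj_onI) (metis lessThan_iff linorder_neqE_nat vertex_neq)

lemma vertex_less: "k < n \<Longrightarrow> vertex k < n"
  using a_le[of k] b_le[of k] m_less by (auto simp: vertex_def)

lemma vertex_in_node: "vertex k \<in> {a k, b k}"
  by (simp add: vertex_def)

text \<open>Two successive steps of the same kind leave the row or column just entered, so that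
  label lies on no other node and is a leaf of the graph.\<close>

lemma vertex_not_corner:
  assumes k: "k < n" "\<not> corner k" and j: "j < n" and mem: "vertex k \<in> {a j, b j}"
  shows "j = k"
proof (cases "a_step k")
  case True
  then have s: "a_step (Suc k)" using k by (simp add: corner_def)
  have "a k < a (Suc k)" "Suc k < n" using a_step_SucD[OF s] by auto
  \<comment> \<open>Since \<open>m \<le> b j\<close>, the label cannot reappear as the larger
    endpoint of an edge.\<close>
  then have "a k < m" using a_le[of "Suc k"] by simp
  then have "a j = a k"
    using mem True b_ge[OF j] by (auto simp: vertex_def)
  then show ?thesis
    using a_step_less[OF True, of j] a_mono[of "Suc k" j] \<open>a k < a (Suc k)\<close> j
    by (cases j k rule: linorder_cases) auto
next
  case False
  then have s: "\<not> a_step (Suc k)" using k by (simp add: corner_def)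
  have "b j = b k"
    using mem False a_le[OF j] b_step_gt[OF False k(1)] by (auto simp: vertex_def)
  then show ?thesis
    using b_step_less[OF False, of j] b_step_less[OF s, of k] b_mono[of "Suc k" j] j k
    by (cases j k rule: linorder_cases) auto
qed

text \<open>The run after corner \<open>i\<close> is of the other kind than the step into
  \<open>i\<close>, so it preserves the coordinate \<open>vertex i\<close>; the last step of the run
  enters \<open>vertex k\<close>.\<close>

lemma consecutive_corners:
  assumes "corner i" "corner k" "i < k" "\<And>j. i < j \<Longrightarrow> j < k \<Longrightarrow> \<not> corner j"
  shows "{a k, b k} = {vertex i, vertex k}"
proof -
  have kn: "k < n" using assms(2) by (simp add: corner_def)
  have run: "a_step j = a_step (Suc i)" if "i < j" "j \<le> k" for j
    using a_step_const[of i k j] assms(4) that kn by (meson less_imp_le)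
  have alt: "a_step i \<noteq> a_step (Suc i)" using assms(1) by (simp add: corner_def)
  show ?thesis
  proof (cases "a_step i")
    case True
    then have "a k = a i" using b_run[of i k] run alt assms(3) kn by (metis less_imp_le)
    then show ?thesis using True run[of k] alt assms(3) by (auto simp: vertex_def)
  next
    case False
    then have "b k = b i" using a_run[of i k] run alt assms(3) kn by (metis less_imp_le)
    then show ?thesis using False run[of k] alt assms(3) by (auto simp: vertex_def)
  qed
qed

text \<open>The wrap-around case that closes the cycle: only \<open>a\<close>-steps precede the
  first corner and only \<open>b\<close>-steps follow the last, so the two share the label
  \<open>m\<close>.\<close>

lemma first_last_corner:
  assumes "corner i" "corner k" "\<And>j. corner j \<Longrightarrow> i \<le> j \<and> j \<le> k"
  shows "{a i, b i} = {vertex k, vertex i}"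
proof -
  have n: "i < n" "k < n" using assms by (auto simp: corner_def)
  have nc: "\<not> corner j" if "j < i \<or> k < j" for j
    using assms(3)[of j] that by auto
  have st: "a_step j" if "j \<le> i" for j
  proof (cases j)
    case (Suc j')
    have "\<not> corner 0" using nc[of 0] that Suc by auto
    then have "a_step (Suc 0)" using a_step_0 n by (simp add: corner_def)
    then show ?thesis
      using a_step_const[of 0 i j] nc that Suc n by (metis less_imp_le zero_less_Suc)
  qed (simp add: a_step_0)
  have "b i = m"
    using a_run[of 0 i] st n b_first by simp
  have nst: "\<not> a_step j" if "k < j" for j
  proof (cases "j \<le> n")
    case True
    have "a_step n = a_step (Suc k)" "a_step j = a_step (Suc k)"
      using a_step_const[of k n n] a_step_const[of k n j] nc that True n by blast+
    then show ?thesis using not_a_step_n[of n] by simp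
  qed (simp add: not_a_step_n)
  have "a k = m"
    using b_run[of k "n - Suc 0"] nst n by (simp add: a_last)
  moreover have "a_step k"
    using assms(2) nst[of "Suc k"] by (simp add: corner_def)
  ultimately show ?thesis
    using st[of i] \<open>b i = m\<close> by (auto simp: vertex_def)
qed

text \<open>A discrete intermediate value argument: take the last \<open>a\<close>-step in the
  range.\<close>

lemma ex_corner_up:
  assumes "i < k" "k \<le> n" "a_step i" "\<not> a_step k"
  shows "\<exists>j. i \<le> j \<and> j < k \<and> a_step j \<and> \<not> a_step (Suc j)"
proof -
  define j where "j = Max {j. i \<le> j \<and> j \<le> k \<and> a_step j}"
  have fin: "finite {j. i \<le> j \<and> j \<le> k \<and> a_step j}" by simp
  have "j \<in> {j. i \<le> j \<and> j \<le> k \<and> a_step j}"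
    unfolding j_def using assms fin less_imp_le[OF assms(1)] by (intro Max_in) blast+
  moreover have "Suc j \<notin> {j. i \<le> j \<and> j \<le> k \<and> a_step j}"
    using Max_ge[OF fin, of "Suc j"] unfolding j_def[symmetric] by auto
  ultimately show ?thesis using assms(4) by (metis (mono_tags, lifting) Suc_leI le_SucI le_neq_implies_less mem_Collect_eq)
qed

lemma ex_corner_down:
  assumes "i < k" "k \<le> n" "\<not> a_step i" "a_step k"
  shows "\<exists>j. i \<le> j \<and> j < k \<and> \<not> a_step j \<and> a_step (Suc j)"
proof -
  define j where "j = Max {j. i \<le> j \<and> j \<le> k \<and> \<not> a_step j}"
  have fin: "finite {j. i \<le> j \<and> j \<le> k \<and> \<not> a_step j}" by simp
  have "j \<in> {j. i \<le> j \<and> j \<le> k \<and> \<not> a_step j}"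
    unfolding j_def using assms fin less_imp_le[OF assms(1)] by (intro Max_in) blast+
  moreover have "Suc j \<notin> {j. i \<le> j \<and> j \<le> k \<and> \<not> a_step j}"
    using Max_ge[OF fin, of "Suc j"] unfolding j_def[symmetric] by auto
  ultimately show ?thesis using assms(4) by (metis (mono_tags, lifting) Suc_leI le_SucI le_neq_implies_less mem_Collect_eq)
qed

lemma finite_corners: "finite {k. corner k}"
  by (rule finite_subset[of _ "{..<n}"]) (auto simp: corner_def)

text \<open>With a single corner, the path would run along row \<open>m\<close> up to the forbidden node \<open>(m, m)\<close>.\<close>

lemma three_le_card_corners: "3 \<le> card {k. corner k}"
proof -
  \<comment> \<open>A \<open>b\<close>-step followed later by an \<open>a\<close>-step suffices:
    between the \<open>a\<close>-step at \<open>0\<close> and the \<open>b\<close>-step at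
    \<open>n\<close> the word then changes kind at least three times.\<close>
  have "\<exists>k. 0 < k \<and> k < n \<and> \<not> a_step k \<and> (\<exists>j. k < j \<and> j < n \<and> a_step j)"
  proof (rule ccontr)
    assume *: "\<not> ?thesis"
    define k where "k = (LEAST k. \<not> a_step k)"
    have k: "\<not> a_step k" unfolding k_def using not_a_step_n[of n] by (intro LeastI) auto
    have before: "a_step j" if "j < k" for j using not_less_Least that unfolding k_def by blast
    have "k \<le> n" using before not_a_step_n[of n] by (meson leI order_refl)
    have "k \<noteq> 0" using k a_step_0 by metis
    then obtain p where p: "k = Suc p" "p < n" using \<open>k \<le> n\<close> by (cases k) auto
    have "b p = m" using a_run[of 0 p] before p by (simp add: b_first)
    moreover have "\<not> a_step j" if "p < j" "j \<le> n - Suc 0" for j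
      using * k p that by (metis Suc_lessI le_less_trans less_Suc_eq_le diff_less zero_less_one
          less_le_trans n3 zero_less_Suc not_a_step_n not_le)
    then have "a (n - Suc 0) = a p" using b_run[of p "n - Suc 0"] p by auto
    ultimately show False using a_less_b[of p] p by (simp add: a_last)
  qed
  then obtain k j where kj: "0 < k" "k < j" "j < n" "\<not> a_step k" "a_step j" by auto
  obtain x where x: "x < k" "a_step x" "\<not> a_step (Suc x)"
    using ex_corner_up[of 0 k] kj a_step_0 by auto
  obtain y where y: "k \<le> y" "y < j" "\<not> a_step y" "a_step (Suc y)"
    using ex_corner_down[of k j] kj by auto
  obtain z where z: "j \<le> z" "z < n" "a_step z" "\<not> a_step (Suc z)"
    using ex_corner_up[of j n] kj not_a_step_n[of n] by auto
  have "{x, y, z} \<subseteq> {k. corner k}" using x y z kj by (auto simp: corner_def)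
  then have "card {x, y, z} \<le> card {k. corner k}" by (rule card_mono[OF finite_corners])
  moreover have "card {x, y, z} = 3" using x y z by simp
  ultimately show ?thesis by simp
qed

text \<open>The node replacing node \<open>k\<close> after a flip: inside the path a corner is cut off the other way,
  while a corner at one end of the path is moved to the opposite end.\<close>

definition flip :: "nat \<Rightarrow> nat \<times> nat" where
  "flip k = (if k = 0 then (Suc m, n - Suc 0) else if k = n - Suc 0 then (0, m - 1)
     else if a_step k then (a k - 1, Suc (b k)) else (Suc (a k), b k - 1))"

definition flippable :: "nat \<Rightarrow> bool" where
  "flippable k \<longleftrightarrow> corner k \<and> fst (flip k) < snd (flip k)"

section \<open>Exchanging one node of the path\<close>

text \<open>Any path through all nodes but \<open>k\<close> arises by a flip at \<open>k\<close>.
  For an inner \<open>k\<close> both ends are shared, so \<open>m' = m\<close> and the nodes around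
  \<open>k\<close> leave one alternative. For an end node, \<open>m\<close> shifts by one.\<close>

lemma shared_nodes_flip:
  assumes "staircase n m' a' b'" and k: "k < n"
    and other: "\<And>j. j < n \<Longrightarrow> j \<noteq> k \<Longrightarrow> \<exists>i<n. a' i = a j \<and> b' i = b j"
    and neq: "\<not> (\<exists>i<n. a' i = a k \<and> b' i = b k)"
  shows "flippable k \<and> (\<exists>i<n. (a' i, b' i) = flip k)"
proof -
  interpret p: staircase n m' a' b' by fact
  have same: "a' j = a j \<and> b' j = b j" if m: "m' = m" and j: "j < n" "j \<noteq> k" for j
  proof -
    obtain i where i: "i < n" "a' i = a j" "b' i = b j" using other[OF j] by blast
    then have "i = j" using p.sum_eq[of i] sum_eq[of j] m j by simp
    then show ?thesis using i by simp
  qed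
  \<comment> \<open>All nodes of the new path satisfy \<open>a' i \<le> m' \<le> b' i\<close>, so a
    surviving first node bounds \<open>m'\<close> from above and a surviving last node bounds it
    from below.\<close>
  have first: "m' \<le> m" if k0: "k \<noteq> 0"
  proof -
    obtain i where "i < n" "b' i = b 0" using other[of 0] k0 k by auto
    then show ?thesis using p.b_ge[of i] b_first by simp
  qed
  have last: "m \<le> m'" if kl: "k \<noteq> n - Suc 0"
  proof -
    obtain i where "i < n" "a' i = a (n - Suc 0)" using other[of "n - Suc 0"] kl k by auto
    then show ?thesis using p.a_le[of i] a_last by simp
  qed
  consider "k = 0" | "k = n - Suc 0" "0 < k" | "0 < k" "Suc k < n" using k by linarith
  then have "corner k \<and> (\<exists>i<n. (a' i, b' i) = flip k)"
  proof cases
    case 1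
    \<comment> \<open>With \<open>m' = m\<close> the new path would start at the removed node
      \<open>(0, m)\<close>.\<close>
    have "m \<noteq> m'"
      using neq 1 n3 p.a_first p.b_first a_first b_first by (metis k)
    then have less: "m < m'" using last 1 n3 by simp
    obtain i where i: "i < n" "a' i = a 1" "b' i = b 1" using other[of 1] 1 n3 by auto
    then have "m < b 1" using p.b_ge[of i] less by simp
    then have "\<not> a_step (Suc 0)" using a_step_SucD[of 0] by (auto simp: b_first)
    then have "corner k" "b 1 = Suc m"
      using 1 b_step_SucD[of 0] a_step_0 n3 by (auto simp: corner_def b_first)
    moreover have "m' = Suc m" using p.b_ge[of i] i less \<open>b 1 = Suc m\<close> by simp
    ultimately show ?thesis
      using 1 n3 p.a_last p.b_last by (auto simp: flip_def intro!: exI[of _ "n - Suc 0"])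
  next
    case 2
    have "m \<noteq> m'"
      using neq 2 n3 p.a_last p.b_last a_last b_last by (metis k)
    then have less: "m' < m" using first 2 by simp
    obtain q where q: "n = Suc (Suc q)" by (rule n_SucSuc)
    obtain i where i: "i < n" "a' i = a q" "b' i = b q" using other[of q] 2 q by auto
    have aq: "a (Suc q) = m" using a_last q by simp
    have "a q < m" using p.a_le[of i] less i by simp
    then have s: "a_step (Suc q)" using b_step_SucD[of q] aq q by auto
    then have "corner k" "Suc (a q) = m"
      using 2 q a_step_SucD[of q] not_a_step_n[of n] aq unfolding corner_def by simp_all
    moreover have "m' = m - 1" using p.a_le[of i] i less \<open>Suc (a q) = m\<close> by simp
    ultimately show ?thesis
      using 2 n3 p.a_first p.b_first by (auto simp: flip_def intro!: exI[of _ 0])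
  next
    case 3
    then have kne: "k \<noteq> 0" "k \<noteq> n - Suc 0" by auto
    then have m: "m' = m" using first last by simp
    obtain q where q: "k = Suc q" using 3 by (cases k) auto
    \<comment> \<open>Both paths have the same coordinate sum at position \<open>k\<close>, so
      different nodes there must differ in the first coordinate.\<close>
    have ne: "a' k \<noteq> a k"
      using neq k sum_eq[of k] p.sum_eq[of k] m by fastforce
    have s: "a' q = a q" "b' q = b q" "a' (Suc k) = a (Suc k)" "b' (Suc k) = b (Suc k)"
      using same[OF m, of q] same[OF m, of "Suc k"] 3 q by auto
    have st: "a' (Suc q) = Suc (a' q) \<and> b' (Suc q) = b' q \<or> a' (Suc q) = a' q \<and> b' (Suc q) = Suc (b' q)"
      "a' (Suc k) = Suc (a' k) \<and> b' (Suc k) = b' k \<or> a' (Suc k) = a' k \<and> b' (Suc k) = Suc (b' k)"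
      using p.step[of q] p.step[of k] 3 q by auto
    show ?thesis
    proof (cases "a_step k")
      case True
      then have "a k = Suc (a q)" "b k = b q" using a_step_SucD[of q] q by auto
      moreover from this have "\<not> a_step (Suc k)"
        using a_step_SucD[of k] s st ne q by auto
      moreover from this have "a (Suc k) = a k" "b (Suc k) = Suc (b k)"
        using b_step_SucD[of k] 3 by auto
      ultimately show ?thesis
        using True kne s st ne q k by (auto simp: flip_def corner_def intro!: exI[of _ k])
    next
      case False
      then have "a k = a q" "b k = Suc (b q)" using b_step_SucD[of q] q k by auto
      moreover from this have "a_step (Suc k)"
        using b_step_SucD[of k] s st ne q 3(2) by (cases "a_step (Suc k)") auto
      moreover from this have "a (Suc k) = Suc (a k)" "b (Suc k) = b k"
        using a_step_SucD[of k] 3 by auto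
      ultimately show ?thesis
        using False kne s st ne q k by (auto simp: flip_def corner_def intro!: exI[of _ k])
    qed
  qed
  then show ?thesis
    using p.a_less_b by (auto simp: flippable_def) (metis fst_conv snd_conv)
qed

text \<open>At an inner corner the new node lies coordinatewise between the nodes
  \<open>k - 1\<close> and \<open>k + 1\<close>, hence in monotone order with all others; the middle
  inequality comes from comparing with \<open>m\<close>.\<close>

lemma flip_interlaced:
  assumes k: "flippable k" and j: "j < n" "j \<noteq> k" and xy: "flip k = (x, y)"
  shows "(a j \<le> x \<and> x \<le> b j \<and> b j \<le> y \<or> x \<le> a j \<and> a j \<le> y \<and> y \<le> b j) \<and>
    y < n \<and> \<not> (x = a j \<and> y = b j) \<and> \<not> (x = a k \<and> y = b k)"
proof -
  have kn: "k < n" "a_step k \<noteq> a_step (Suc k)" and xly: "x < y"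
    using k xy by (auto simp: flippable_def corner_def)
  note bounds = a_le[OF j(1)] b_ge[OF j(1)] b_le[OF j(1)] a_le[OF kn(1)] b_ge[OF kn(1)] b_le[OF kn(1)]
  consider "k = 0" | "k = n - Suc 0" "0 < k" | "0 < k" "Suc k < n" using kn by linarith
  then show ?thesis
  proof cases
    case 1
    then have x: "x = Suc m" "y = n - Suc 0" using xy by (auto simp: flip_def)
    have "b 1 = Suc m" using kn 1 b_step_SucD[of 0] a_step_0 n3 by (auto simp: b_first)
    then have "Suc m \<le> b j" using b_mono[of 1 j] j 1 by auto
    then show ?thesis using x bounds n3 by auto
  next
    case 2
    then have x: "x = 0" "y = m - 1" using xy by (auto simp: flip_def)
    obtain q where q: "n = Suc (Suc q)" by (rule n_SucSuc)
    have "a_step (Suc q)" using kn 2 q not_a_step_n[of n] by auto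
    then have "Suc (a q) = m" using a_step_SucD[of q] a_last q by simp
    then have "a j \<le> m - 1" using a_mono[of j q] j 2 q by auto
    then show ?thesis using x bounds m_pos m_less by auto
  next
    case 3
    then have kne: "k \<noteq> 0" "k \<noteq> n - Suc 0" by auto
    obtain q where q: "k = Suc q" using 3 by (cases k) auto
    have jj: "j \<le> q \<or> Suc k \<le> j" using j q by auto
    have mon: "j \<le> q \<Longrightarrow> a j \<le> a q \<and> b j \<le> b q" "Suc k \<le> j \<Longrightarrow> a (Suc k) \<le> a j \<and> b (Suc k) \<le> b j"
      using a_mono[of j q] b_mono[of j q] a_mono[of "Suc k" j] b_mono[of "Suc k" j] j q kn by auto
    have "a q \<le> m" "m \<le> b q" "b (Suc k) \<le> n - Suc 0" "a (Suc k) \<le> m"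
      using a_le b_ge b_le 3 q by auto
    note bounds = bounds this
    have sums: "a j + b j = m + j" "a k + b k = m + k" using sum_eq j kn by auto
    show ?thesis
    proof (cases "a_step k")
      case True
      then have "a k = Suc (a q)" "b k = b q" using a_step_SucD[of q] q by auto
      moreover have "a (Suc k) = a k" "b (Suc k) = Suc (b k)"
        using b_step_SucD[of k] 3 kn True by auto
      moreover have "x = a k - 1" "y = Suc (b k)" using xy kne True by (auto simp: flip_def)
      ultimately show ?thesis using jj mon bounds sums j(2) 3 by auto
    next
      case False
      then have "a k = a q" "b k = Suc (b q)" using b_step_SucD[of q] q kn by auto
      moreover have "a (Suc k) = Suc (a k)" "b (Suc k) = b k"
        using a_step_SucD[of k] kn False by auto
      moreover have "x = Suc (a k)" "y = b k - 1" using xy kne False by (auto simp: flip_def)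
      ultimately show ?thesis using jj mon bounds sums j(2) 3 by auto
    qed
  qed
qed

end

section \<open>Counting the flippable corners\<close>

context staircase
begin

text \<open>A blocked corner is so close to the diagonal or the boundary that the rest of the path
  is forced, leaving at most three positions for corners.\<close>

lemma card_corners_not_flippable:
  assumes "corner k" "\<not> flippable k"
  shows "card {k. corner k} = 3"
proof -
  have kn: "k < n" "a_step k \<noteq> a_step (Suc k)" and ge: "\<not> fst (flip k) < snd (flip k)"
    using assms by (auto simp: flippable_def corner_def)
  consider "k = 0" | "k = n - Suc 0" "0 < k" | "0 < k" "Suc k < n" using kn by linarith
  then have "\<exists>x y z. {k. corner k} \<subseteq> {x, y, z}"
  proof cases
    case 1
    \<comment> \<open>The first step already takes \<open>b\<close> to its maximum, so all later
      steps are \<open>a\<close>-steps.\<close>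
    have "\<not> Suc m < n - Suc 0" using ge 1 by (simp add: flip_def)
    moreover have "b 1 = Suc m" using kn 1 b_step_SucD[of 0] a_step_0 n3 by (auto simp: b_first)
    ultimately have "a_step j" if "1 < j" "j < n" for j
      using b_step_less[of j 1] b_le[of j] that by auto
    then have "j \<in> {0, 1, n - Suc 0}" if "corner j" for j
      using that by (auto simp: corner_def)
    then show ?thesis by (metis mem_Collect_eq subsetI)
  next
    case 2
    \<comment> \<open>Only one \<open>a\<close>-step is available inside the path, and it is the
      last step.\<close>
    then have "m = 1" using ge m_pos by (simp add: flip_def)
    have "a_step (n - Suc 0)" using kn 2 not_a_step_n[of n] by auto
    then have "\<not> a_step j" if "0 < j" "j < n - Suc 0" for j
      using a_step_less[of "n - Suc 0" j] a_step_less[of j 0] that \<open>m = 1\<close> a_last by auto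
    then have "j \<in> {0, n - 2, n - Suc 0}" if "corner j" for j
      using that by (auto simp: corner_def)
    then show ?thesis by (metis mem_Collect_eq subsetI)
  next
    case 3
    then have kne: "k \<noteq> 0" "k \<noteq> n - Suc 0" by auto
    \<comment> \<open>A corner entered by an \<open>a\<close>-step flips away from the diagonal and
      is never blocked.\<close>
    have "\<not> a_step k"
      using ge kne a_less_b[OF kn(1)] by (auto simp: flip_def)
    then have s: "a_step (Suc k)" using kn by simp
    have "a k < m" using a_step_SucD[OF s] a_le[of "Suc k"] by auto
    moreover have "m < b k" using b_step_gt[of k] kn \<open>\<not> a_step k\<close> by simp
    \<comment> \<open>The corner is \<open>(m - 1, m + 1)\<close>, and its flip would be the
      forbidden \<open>(m, m)\<close>.\<close>
    ultimately have eq: "Suc (a k) = m" "b k = Suc m"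
      using ge kne \<open>\<not> a_step k\<close> by (auto simp: flip_def)
    have up: "a_step j" if "j < k" for j
      using b_step_gt[of j] b_step_less[OF \<open>\<not> a_step k\<close> that] that kn eq by auto
    have down: "\<not> a_step j" if "Suc k < j" for j
      using a_step_less[of j "Suc k"] a_step_SucD[OF s] a_le[of j] not_a_step_n[of j] that eq
      by (cases "j < n") auto
    have "j \<in> {k - 1, k, Suc k}" if "corner j" for j
    proof (rule ccontr)
      assume "j \<notin> {k - 1, k, Suc k}"
      then consider "Suc j < k" | "Suc k < j" by fastforce
      then show False
        using that up[of j] up[of "Suc j"] down[of j] down[of "Suc j"]
        by cases (simp_all add: corner_def)
    qed
    then show ?thesis by (metis mem_Collect_eq subsetI)
  qed
  then obtain x y z where xyz: "{k. corner k} \<subseteq> {x, y, z}" by blast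
  have "card {k. corner k} \<le> card {x, y, z}" by (rule card_mono[OF _ xyz]) simp
  also have "\<dots> \<le> 3" by (simp add: card_insert_if)
  finally show ?thesis using three_le_card_corners by simp
qed

text \<open>Three corners cut the path into four straight pieces of kinds \<open>a\<close>,
  \<open>b\<close>, \<open>a\<close>, \<open>b\<close>, the outer ones possibly without steps, so
  all coordinates become explicit.\<close>

lemma three_cornersE:
  assumes "card {k. corner k} = 3"
  obtains i j k where "{k. corner k} = {i, j, k}" "i < j" "j < k" "k < n" "m + j = i + k"
    "a_step i" "\<not> a_step j" "a_step k"
    "\<And>x. x \<le> i \<Longrightarrow> a x = x \<and> b x = m"
    "\<And>x. i \<le> x \<Longrightarrow> x \<le> j \<Longrightarrow> a x = i \<and> b x = m + (x - i)"
    "\<And>x. j \<le> x \<Longrightarrow> x \<le> k \<Longrightarrow> a x = i + (x - j) \<and> b x = k"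
    "\<And>x. k \<le> x \<Longrightarrow> x < n \<Longrightarrow> a x = m \<and> b x = k + (x - k)"
proof -
  define ls where "ls = sorted_list_of_set {k. corner k}"
  have "length ls = Suc (Suc (Suc 0))" "sorted_wrt (<) ls" and set: "set ls = {k. corner k}"
    using assms finite_corners by (simp_all add: ls_def)
  then obtain i j k where ls: "ls = [i, j, k]" by (auto simp: length_Suc_conv)
  have L: "{k. corner k} = {i, j, k}" using set ls by simp
  have ord: "i < j" "j < k" using \<open>sorted_wrt (<) ls\<close> ls by auto
  have cor: "corner i" "corner j" "corner k" and nc: "\<And>x. x \<noteq> i \<Longrightarrow> x \<noteq> j \<Longrightarrow> x \<noteq> k \<Longrightarrow> \<not> corner x"
    using L by blast+
  have kn: "k < n" using cor by (simp add: corner_def)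
  have alt: "a_step (Suc i) = (\<not> a_step i)" "a_step (Suc j) = (\<not> a_step j)" "a_step (Suc k) = (\<not> a_step k)"
    using cor by (auto simp: corner_def)
  have r1: "a_step x = a_step (Suc i)" if "i < x" "x \<le> j" for x
    using a_step_const[of i j x] nc that ord kn by (metis less_imp_le less_irrefl less_trans)
  have r2: "a_step x = a_step (Suc j)" if "j < x" "x \<le> k" for x
    using a_step_const[of j k x] nc that ord kn by (metis less_imp_le less_irrefl less_trans)
  have r3: "a_step x = a_step (Suc k)" if "k < x" "x \<le> n" for x
    using a_step_const[of k n x] nc that ord kn by (metis order_refl less_irrefl less_trans)
  \<comment> \<open>The kinds of the pieces are found backwards, starting from the
    \<open>b\<close>-step at \<open>n\<close>.\<close>
  have s3: "\<not> a_step x" if "k < x" for x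
    using r3[of n] r3[of x] not_a_step_n[of n] not_a_step_n[of x] kn that by (metis le_less_linear less_imp_le order_refl)
  have sk: "a_step k" using s3[of "Suc k"] alt by simp
  then have s2: "a_step x" if "j < x" "x \<le> k" for x
    using r2[OF that] r2[of k] ord by simp
  have sj: "\<not> a_step j" using s2[of "Suc j"] alt ord by simp
  then have s1: "\<not> a_step x" if "i < x" "x \<le> j" for x
    using r1[OF that] r1[of j] ord by simp
  have si: "a_step i" using s1[of "Suc i"] alt ord by simp
  have s0: "a_step x" if xi: "x \<le> i" for x
  proof (rule ccontr)
    assume "\<not> a_step x"
    moreover from this have "0 < x" using a_step_0 by (metis neq0_conv)
    ultimately obtain y where y: "y < x" "a_step y" "\<not> a_step (Suc y)"
      using ex_corner_up[of 0 x] a_step_0 xi ord kn by auto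
    then have "corner y" using xi ord kn by (simp add: corner_def)
    then show False using nc[of y] y xi ord by auto
  qed
  have f0: "a x = x \<and> b x = m" if "x \<le> i" for x
    using a_run[of 0 x] s0 that ord kn by (simp add: a_first b_first)
  have f1: "a x = i \<and> b x = m + (x - i)" if "i \<le> x" "x \<le> j" for x
    using b_run[of i x] s1 f0[of i] that ord kn by simp
  have f2: "a x = i + (x - j) \<and> b x = m + (j - i)" if "j \<le> x" "x \<le> k" for x
    using a_run[of j x] s2 f1[of j] that ord kn by simp
  have f3: "a x = i + (k - j) \<and> b x = m + (j - i) + (x - k)" if "k \<le> x" "x < n" for x
    using b_run[of k x] s3 f2[of k] that ord kn by simp
  \<comment> \<open>The last node has first coordinate \<open>m\<close>; this also identifies the
    height \<open>m + (j - i)\<close> of the third piece with \<open>k\<close>.\<close>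
  have m: "m = i + (k - j)"
    using f3[of "n - Suc 0"] kn a_last by simp
  then have mk: "m + (j - i) = k" "m + j = i + k" using ord by auto
  show thesis
    by (rule that[OF L ord kn mk(2) si sj sk f0 f1 f2[unfolded mk(1)] f3[folded m, unfolded mk(1)]])
qed

definition incident :: "nat \<Rightarrow> nat set" where
  "incident x = {k. k < n \<and> x \<in> {a k, b k}}"

text \<open>Every label is thus entered exactly once, so a label is either the vertex of a corner or
  a leaf.\<close>

lemma vertex_image: "vertex ` {..<n} = {..<n}"
  using inj_on_vertex vertex_less by (intro endo_inj_surj) auto

text \<open>With three corners the cyclic word has three runs. A vertex has degree two iff it is the
  corner vertex preceding a run of length one, and a corner is blocked iff it separates two such
  runs.\<close>

lemma card_flippable_three_corners:
  assumes c3: "card {k. corner k} = 3" and n4: "4 \<le> n"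
  shows "card {k. flippable k} = (if card {x. x < n \<and> card (incident x) = 2} = 2 then 2 else 3)"
proof -
  from c3 obtain i j k where L: "{k. corner k} = {i, j, k}" and ord: "i < j" "j < k" "k < n"
    and m: "m + j = i + k" and st: "a_step i" "\<not> a_step j" "a_step k"
    and f0: "\<And>x. x \<le> i \<Longrightarrow> a x = x \<and> b x = m"
    and f1: "\<And>x. i \<le> x \<Longrightarrow> x \<le> j \<Longrightarrow> a x = i \<and> b x = m + (x - i)"
    and f2: "\<And>x. j \<le> x \<Longrightarrow> x \<le> k \<Longrightarrow> a x = i + (x - j) \<and> b x = k"
    and f3: "\<And>x. k \<le> x \<Longrightarrow> x < n \<Longrightarrow> a x = m \<and> b x = k + (x - k)"
    by (rule three_cornersE) blast
  have imk: "i < m" "m < k" using m ord by auto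
  \<comment> \<open>\<open>P\<close>, \<open>Q\<close> and \<open>R\<close> say that a cyclic run
    has length one; the run of \<open>R\<close> passes through the two ends of the path.\<close>
  define P where "P \<longleftrightarrow> j = Suc i"
  define Q where "Q \<longleftrightarrow> k = Suc j"
  define R where "R \<longleftrightarrow> i = 0 \<and> Suc k = n"
  \<comment> \<open>Three runs of length one would give \<open>n = 3\<close>.\<close>
  have notall: "\<not> (P \<and> Q \<and> R)" using n4 by (auto simp: P_def Q_def R_def)
  have vals: "a i = i" "b i = m" "a j = i" "b j = k" "a k = m" "b k = k"
    using f0[of i] f2[of j] f3[of k] ord by auto
  have cor: "corner i" "corner j" "corner k" and nc: "\<And>x. corner x \<Longrightarrow> x \<in> {i, j, k}"
    using L by blast+
  have ne: "i \<noteq> n - Suc 0" "j \<noteq> n - Suc 0" "j \<noteq> 0" "k \<noteq> 0" using ord by auto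
  have "flip i = (if i = 0 then (Suc m, n - Suc 0) else (i - 1, Suc m))"
    using ne st vals by (simp add: flip_def)
  then have "flippable i \<longleftrightarrow> \<not> (P \<and> R)"
    using cor ord m imk by (auto simp: flippable_def P_def R_def)
  moreover have "flip j = (Suc i, k - 1)"
    using ne st vals by (simp add: flip_def)
  then have "flippable j \<longleftrightarrow> \<not> (P \<and> Q)"
    using cor ord m imk by (auto simp: flippable_def P_def Q_def)
  moreover have "flip k = (if k = n - Suc 0 then (0, m - 1) else (m - 1, Suc k))"
    using ne st vals by (simp add: flip_def)
  then have "flippable k \<longleftrightarrow> \<not> (Q \<and> R)"
    using cor ord m imk by (auto simp: flippable_def Q_def R_def)
  ultimately have F: "{k. flippable k} =
      (if P \<and> R then {} else {i}) \<union> (if P \<and> Q then {} else {j}) \<union> (if Q \<and> R then {} else {k})"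
    using nc by (auto simp: flippable_def)
  have ab: "a x = (if x \<le> i then x else if x \<le> j then i else if x \<le> k then i + (x - j) else m)"
    "b x = (if x \<le> i then m else if x \<le> j then m + (x - i) else if x \<le> k then k else x)"
    if "x < n" for x
    using f0[of x] f1[of x] f2[of x] f3[of x] that by auto
  \<comment> \<open>The vertices of the three corners are \<open>i\<close>, \<open>k\<close> and
    \<open>m\<close>; each lies on its own corner and on all nodes of the run that follows.\<close>
  have inc: "incident i = {i..j}" "incident k = {j..k}" "incident m = {0..i} \<union> {k..<n}"
    unfolding incident_def using ord imk m by (auto simp: ab split: if_splits)
  have "card (incident i) = 2 \<longleftrightarrow> P" "card (incident k) = 2 \<longleftrightarrow> Q"
    using ord by (auto simp: inc P_def Q_def)
  moreover have "card (incident m) = Suc i + (n - k)"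
    unfolding inc using ord by (subst card_Un_disjoint) auto
  then have "card (incident m) = 2 \<longleftrightarrow> R" using ord by (auto simp: R_def)
  moreover have "card (incident x) \<noteq> 2" if x: "x < n" "x \<notin> {i, k, m}" for x
  proof -
    obtain y where y: "y < n" "x = vertex y" using x(1) vertex_image by blast
    have "vertex i = i" "vertex j = k" "vertex k = m" using st vals by (auto simp: vertex_def)
    then have "\<not> corner y" using nc[of y] y x(2) by auto
    then have "incident x = {y}"
      using vertex_not_corner[of y] vertex_in_node[of y] y by (auto simp: incident_def)
    then show ?thesis by simp
  qed
  ultimately have S: "{x. x < n \<and> card (incident x) = 2} =
      (if P then {i} else {}) \<union> (if Q then {k} else {}) \<union> (if R then {m} else {})"
    using ord imk by (auto split: if_splits)
  show ?thesis
    unfolding F S using notall ord imk by (cases P; cases Q; cases R) auto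
qed

lemma card_flippable:
  assumes "4 \<le> n"
  shows "card {k. flippable k} =
    (if card {k. corner k} = 3 \<and> card {x. x < n \<and> card (incident x) = 2} = 2
     then 2 else card {k. corner k})"
proof (cases "card {k. corner k} = 3")
  case True
  then show ?thesis using card_flippable_three_corners[OF True assms] by simp
next
  case False
  then have "{k. flippable k} = {k. corner k}"
    using card_corners_not_flippable by (auto simp: flippable_def)
  then show ?thesis using False by simp
qed

end

section \<open>Cycles in graphs\<close>

lemma mod_eq_of_Suc_mod_eq: "Suc i mod L = Suc j mod L \<Longrightarrow> i mod L = j mod (L :: nat)"
  by (cases "L = 0") (auto simp: mod_Suc split: if_splits)

text \<open>The vertex list is extended periodically to all naturals, so that consecutive edges can
  be followed without a wrap-around case.\<close>

lemma graph_cycle_cyclicE: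
  assumes "graph_cycle E C"
  obtains L c where "3 \<le> L" "C \<subseteq> E" "C = range (\<lambda>i. {c i, c (Suc i)})"
    "\<And>i j. c i = c j \<longleftrightarrow> i mod L = j mod L"
proof -
  obtain vs where vs: "C \<subseteq> E" "distinct vs" "3 \<le> length vs"
    and C: "C = {{vs ! i, vs ! (Suc i mod length vs)} | i. i < length vs}"
    using assms by (auto simp: graph_cycle_def)
  define L where "L = length vs"
  define c where "c i = vs ! (i mod L)" for i
  have L: "0 < L" using vs by (auto simp: L_def)
  have "C = range (\<lambda>i. {c i, c (Suc i)})"
  proof (intro equalityI subsetI)
    fix e assume "e \<in> C"
    then obtain i where "i < L" "e = {vs ! i, vs ! (Suc i mod L)}" using C by (auto simp: L_def)
    then have "e = {c i, c (Suc i)}" by (simp add: c_def)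
    then show "e \<in> range (\<lambda>i. {c i, c (Suc i)})" by blast
  next
    fix e assume "e \<in> range (\<lambda>i. {c i, c (Suc i)})"
    then obtain i where "e = {c i, c (Suc i)}" by blast
    then have "e = {vs ! (i mod L), vs ! (Suc (i mod L) mod L)}" by (simp add: c_def mod_Suc_eq)
    then show "e \<in> C" using L unfolding C L_def by auto
  qed
  moreover have "c i = c j \<longleftrightarrow> i mod L = j mod L" for i j
    using L vs(2) by (simp add: c_def L_def nth_eq_iff_index_eq)
  ultimately show thesis using that vs by (auto simp: L_def)
qed

text \<open>As the length is at least three, \<open>c t\<close> and \<open>c (Suc (Suc t))\<close>
  differ, so the two edges at a vertex are distinct. This keeps edges with a leaf out of
  cycles.\<close>

lemma graph_cycle_other_edge:
  assumes "graph_cycle E C" "e \<in> C" "v \<in> e"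
  shows "\<exists>e' \<in> C. e' \<noteq> e \<and> v \<in> e'"
proof -
  obtain L c where L: "3 \<le> L" and C: "C = range (\<lambda>i. {c i, c (Suc i)})"
    and c: "\<And>i j. c i = c j \<longleftrightarrow> i mod L = j mod L"
    using assms(1) by (rule graph_cycle_cyclicE) blast
  obtain i where i: "e = {c i, c (Suc i)}" using assms C by auto
  have "c t \<noteq> c (Suc (Suc t))" for t
    using L by (auto simp: c mod_Suc split: if_splits)
  then have ne: "{c t, c (Suc t)} \<noteq> {c (Suc t), c (Suc (Suc t))}" for t
    by (metis doubleton_eq_iff)
  show ?thesis
  proof (cases "v = c (Suc i)")
    case True
    then show ?thesis using ne[of i] i C by (intro bexI[of _ "{c (Suc i), c (Suc (Suc i))}"]) auto
  next
    case False
    then have v: "v = c i" using assms i by auto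
    \<comment> \<open>The predecessor of \<open>i\<close> modulo \<open>L\<close>, which exists also
      for \<open>i = 0\<close>.\<close>
    define t where "t = i + (L - 1)"
    have "Suc t mod L = i mod L" using L by (simp add: t_def)
    then have "c (Suc t) = c i" "c (Suc (Suc t)) = c (Suc i)"
      by (auto simp: c) (metis mod_Suc_eq)
    then show ?thesis using ne[of t] i C v by (intro bexI[of _ "{c t, c (Suc t)}"]) auto
  qed
qed

text \<open>From one edge of \<open>C'\<close>, the second edge at its endpoint can only be the next
  edge of \<open>C\<close>, so \<open>C'\<close> runs all the way round.\<close>

lemma graph_cycle_subset_eq:
  assumes "graph_cycle E C" "graph_cycle E' C'" "C' \<subseteq> C"
  shows "C' = C"
proof -
  obtain L c where L: "3 \<le> L" and C: "C = range (\<lambda>i. {c i, c (Suc i)})"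
    and c: "\<And>i j. c i = c j \<longleftrightarrow> i mod L = j mod L"
    using assms(1) by (rule graph_cycle_cyclicE) blast
  have "C' \<noteq> {}"
    using assms(2) by (rule graph_cycle_cyclicE) auto
  then obtain i where i: "{c i, c (Suc i)} \<in> C'" using C assms(3) by blast
  have up: "{c t, c (Suc t)} \<in> C'" if "i \<le> t" for t
    using that
  proof (induction t rule: dec_induct)
    case (step t)
    obtain e where e: "e \<in> C'" "e \<noteq> {c t, c (Suc t)}" "c (Suc t) \<in> e"
      using graph_cycle_other_edge[OF assms(2) step.IH, of "c (Suc t)"] by auto
    obtain s where s: "e = {c s, c (Suc s)}" using e C assms(3) by auto
    have "c s \<noteq> c t"
    proof
      assume st: "c s = c t"
      then have "c (Suc s) = c (Suc t)" by (metis c mod_Suc_eq)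
      then show False using st s e by simp
    qed
    then have "c (Suc s) \<noteq> c (Suc t)" by (metis c mod_eq_of_Suc_mod_eq)
    then have "c s = c (Suc t)" using e s by auto
    moreover from this have "c (Suc s) = c (Suc (Suc t))" by (metis c mod_Suc_eq)
    ultimately show ?case using e s by simp
  qed (rule i)
  have "{c t, c (Suc t)} \<in> C'" for t
  proof -
    \<comment> \<open>A multiple of the period lifts any index above the starting index
      \<open>i\<close>.\<close>
    have "c (t + i * L) = c t" "c (Suc (t + i * L)) = c (Suc t)"
      using mod_mult_self1[of "Suc t" i L] by (auto simp: c)
    moreover have "i \<le> t + i * L" using L by (cases L) auto
    ultimately show ?thesis using up[of "t + i * L"] by simp
  qed
  then show ?thesis using C assms(3) by auto
qed

section \<open>The graph of the path: degrees and the unique cycle\<close>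

locale thrackle_staircase = staircase "CARD('n)" m a b
  for m :: nat and a b :: "nat \<Rightarrow> nat" and E :: "'n::{finite,linorder} set set" +
  assumes E_eq: "E = (\<lambda>k. {ix (a k), ix (b k)}) ` {..<CARD('n)}"
    and max_thrackle_E: "max_thrackle E"
begin

definition node :: "nat \<Rightarrow> 'n set" where
  "node k = {ix (a k), ix (b k)}"

lemma E_node: "E = node ` {..<CARD('n)}"
  by (simp add: E_eq node_def)

lemma ab_less: "k < CARD('n) \<Longrightarrow> a k < CARD('n) \<and> b k < CARD('n)"
  using a_less_b[of k] b_le[of k] n3 by linarith

lemma lo_node: "k < CARD('n) \<Longrightarrow> lo (node k) = a k"
  and hi_node: "k < CARD('n) \<Longrightarrow> hi (node k) = b k"
  using a_less_b[of k] ab_less[of k] by (simp_all add: node_def lo_edge hi_edge)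

lemma inj_on_node: "inj_on node {..<CARD('n)}"
proof (rule inj_onI)
  fix i j assume "i \<in> {..<CARD('n)}" "j \<in> {..<CARD('n)}" "node i = node j"
  then show "i = j" using lo_node hi_node sum_eq by (metis add_left_cancel lessThan_iff)
qed

lemma ix_in_node_iff: "k < CARD('n) \<Longrightarrow> x < CARD('n) \<Longrightarrow> ix x \<in> node k \<longleftrightarrow> x \<in> {a k, b k}"
  using ab_less[of k] by (simp add: node_def ix_eq_iff)

lemma vertex_degree_ix:
  assumes "x < CARD('n)"
  shows "vertex_degree E (ix x) = card (incident x)"
proof -
  have "{e \<in> E. ix x \<in> e} = node ` incident x"
    using assms by (auto simp: E_node incident_def ix_in_node_iff)
  moreover have "inj_on node (incident x)"
    by (rule inj_on_subset[OF inj_on_node]) (auto simp: incident_def)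
  ultimately show ?thesis by (simp add: vertex_degree_def card_image)
qed

lemma card_vertex_degree_2:
  "card {v. vertex_degree E v = 2} = card {x. x < CARD('n) \<and> card (incident x) = 2}"
proof -
  let ?X = "{x. x < CARD('n) \<and> card (incident x) = 2}"
  have "v \<in> ix ` ?X" if "vertex_degree E v = 2" for v
  proof (rule image_eqI)
    show "v = ix (rk v)" by simp
    show "rk v \<in> ?X" using vertex_degree_ix[of "rk v"] rk_less_card[of v] that by simp
  qed
  then have "{v. vertex_degree E v = 2} = ix ` ?X"
    by (auto simp: vertex_degree_ix)
  moreover have "inj_on (ix :: nat \<Rightarrow> 'n) ?X"
    by (rule inj_on_subset[OF inj_on_ix]) auto
  ultimately show ?thesis by (simp add: card_image)
qed

text \<open>The cycle visits the vertices of the corners in path order; the edge between two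
  successive vertices is the later corner, and the first corner closes the cycle.\<close>

lemma graph_cycle_corners: "graph_cycle E (node ` {k. corner k})"
proof -
  define ls where "ls = sorted_list_of_set {k. corner k}"
  define L where "L = length ls"
  have ls: "set ls = {k. corner k}" "distinct ls" "sorted_wrt (<) ls"
    using finite_corners by (simp_all add: ls_def)
  have L: "3 \<le> L" using three_le_card_corners finite_corners by (simp add: L_def ls_def)
  have cor: "corner (ls ! i)" if "i < L" for i
    using that ls(1) nth_mem[of i ls] by (simp add: L_def)
  have mono: "ls ! i < ls ! j" if "i < j" "j < L" for i j
    using that ls(3) by (simp add: L_def sorted_wrt_iff_nth_less)
  have idx: "\<exists>i<L. x = ls ! i" if "corner x" for x
    using that ls(1) unfolding L_def by (metis in_set_conv_nth mem_Collect_eq)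
  have le: "ls ! i \<le> ls ! j" if "i \<le> j" "j < L" for i j
    using mono[of i j] that by (cases "i = j") auto
  define vs where "vs = map (\<lambda>k. ix (vertex k) :: 'n) ls"
  have cN: "{k. corner k} \<subseteq> {..<CARD('n)}" by (auto simp: corner_def)
  have "distinct vs"
  proof -
    have "inj_on (ix :: nat \<Rightarrow> 'n) (vertex ` {..<CARD('n)})" using inj_on_ix unfolding vertex_image .
    then have "inj_on ((ix :: nat \<Rightarrow> 'n) \<circ> vertex) {..<CARD('n)}" using inj_on_vertex by (rule comp_inj_on[rotated])
    then have "inj_on ((ix :: nat \<Rightarrow> 'n) \<circ> vertex) (set ls)" using cN ls(1) by (metis inj_on_subset)
    then show ?thesis using ls(2) by (simp add: vs_def distinct_map comp_def)
  qed
  moreover have "length vs = L" by (simp add: vs_def L_def)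
  moreover have edge: "{vs ! i, vs ! (Suc i mod L)} = node (ls ! (Suc i mod L))" if i: "i < L" for i
  proof -
    have "{vertex (ls ! i), vertex (ls ! (Suc i mod L))} =
        {a (ls ! (Suc i mod L)), b (ls ! (Suc i mod L))}"
    proof (cases "Suc i = L")
      case True
      have "ls ! 0 \<le> x \<and> x \<le> ls ! i" if c: "corner x" for x
      proof -
        obtain t where "t < L" "x = ls ! t" using idx[OF c] by blast
        then show ?thesis using le[of 0 t] le[of t i] True by simp
      qed
      then show ?thesis
        using first_last_corner[of "ls ! 0" "ls ! i"] cor[of 0] cor[of i] L i True by simp
    next
      case False
      then have Si: "Suc i < L" using i by simp
      have "\<not> corner x" if x: "ls ! i < x" "x < ls ! Suc i" for x
      proof
        assume "corner x"
        then obtain t where t: "t < L" "x = ls ! t" using idx by blast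
        have "t \<le> i \<or> Suc i \<le> t" by linarith
        then show False using t x le[of t i] le[of "Suc i" t] i by auto
      qed
      then show ?thesis
        using consecutive_corners[of "ls ! i" "ls ! Suc i"] cor[OF i] cor[OF Si] mono[of i "Suc i"] Si
        by simp
    qed
    then have "ix ` {vertex (ls ! i), vertex (ls ! (Suc i mod L))} =
        (ix :: nat \<Rightarrow> 'n) ` {a (ls ! (Suc i mod L)), b (ls ! (Suc i mod L))}" by (rule arg_cong)
    moreover have "Suc i mod L < L" using L by simp
    ultimately show ?thesis using i unfolding node_def vs_def L_def by simp
  qed
  moreover have "node ` {k. corner k} = {{vs ! i, vs ! (Suc i mod L)} | i. i < L}"
  proof (intro equalityI subsetI)
    fix e assume "e \<in> node ` {k. corner k}"
    then obtain t where t: "t < L" "e = node (ls ! t)" using idx by auto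
    \<comment> \<open>The edge leaving the \<open>i\<close>-th vertex is the corner with the next
      index, so corner \<open>t\<close> is reached from its cyclic predecessor.\<close>
    define i where "i = (if t = 0 then L - 1 else t - 1)"
    have "i < L" "Suc i mod L = t" using t L by (auto simp: i_def)
    then show "e \<in> {{vs ! i, vs ! (Suc i mod L)} | i. i < L}" using edge[of i] t by auto
  next
    fix e assume "e \<in> {{vs ! i, vs ! (Suc i mod L)} | i. i < L}"
    then obtain i where i: "i < L" "e = node (ls ! (Suc i mod L))" using edge by auto
    moreover have "Suc i mod L < L" using L by simp
    ultimately show "e \<in> node ` {k. corner k}" using cor by blast
  qed
  moreover have "node ` {k. corner k} \<subseteq> E" unfolding E_node using cN by (rule image_mono)
  ultimately show ?thesis
    unfolding graph_cycle_def using L by (intro conjI exI[of _ vs]) simp_all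
qed

text \<open>A node that is not a corner has a leaf, hence lies on no cycle. Every cycle is therefore
  contained in the cycle of corners and equals it.\<close>

lemma unique_cycle_eq: "unique_cycle E = node ` {k. corner k}"
  unfolding unique_cycle_def
proof (rule the_equality)
  fix C assume C: "graph_cycle E C"
  have "e \<in> node ` {k. corner k}" if e: "e \<in> C" for e
  proof -
    have CE: "C \<subseteq> E" using C by (simp add: graph_cycle_def)
    then obtain k where k: "k < CARD('n)" "e = node k" using e E_node by auto
    have "corner k"
    proof (rule ccontr)
      assume nc: "\<not> corner k"
      have mem: "ix (vertex k) \<in> node k"
        using ix_in_node_iff[OF k(1) vertex_less[OF k(1)]] vertex_in_node by simp
      then obtain e' where e': "e' \<in> C" "e' \<noteq> e" "ix (vertex k) \<in> e'"
        using graph_cycle_other_edge[OF C e] k by blast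
      then obtain j where j: "j < CARD('n)" "e' = node j" using CE E_node by auto
      then have "vertex k \<in> {a j, b j}" using e' ix_in_node_iff[OF j(1) vertex_less[OF k(1)]] by simp
      then have "j = k" using vertex_not_corner[OF k(1) nc j(1)] by simp
      then show False using e' j k by simp
    qed
    then show ?thesis using k by blast
  qed
  then show "C = node ` {k. corner k}"
    using graph_cycle_subset_eq[OF graph_cycle_corners C] by blast
qed (rule graph_cycle_corners)

lemma card_unique_cycle: "card (unique_cycle E) = card {k. corner k}"
  unfolding unique_cycle_eq
  by (rule card_image, rule inj_on_subset[OF inj_on_node]) (auto simp: corner_def)

section \<open>Flips and neighbouring maximal thrackles\<close>

definition flipped :: "nat \<Rightarrow> 'n set set" where
  "flipped k = insert {ix (fst (flip k)), ix (snd (flip k))} (E - {node k})"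

lemma card_E: "card E = CARD('n)"
  using max_thrackle_E by (simp add: max_thrackle_def)

lemma
  assumes k: "flippable k"
  shows max_thrackle_flipped: "max_thrackle (flipped k)"
    and E_minus_flipped: "E - flipped k = {node k}"
proof -
  obtain x y where xy: "flip k = (x, y)" by (cases "flip k")
  have kn: "k < CARD('n)" and less: "x < y" using k xy by (auto simp: flippable_def corner_def)
  define e where "e = {ix x, ix y :: 'n}"
  have fl: "flipped k = insert e (E - {node k})" by (simp add: flipped_def e_def xy)
  \<comment> \<open>Any node other than \<open>k\<close> gives access to the conclusions of
    \<open>flip_interlaced\<close> that do not mention \<open>j\<close>.\<close>
  define j0 :: nat where "j0 = (if k = 0 then 1 else 0)"
  have j0: "j0 < CARD('n)" "j0 \<noteq> k" using n3 by (auto simp: j0_def)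
  have yN: "y < CARD('n)" and nk: "\<not> (x = a k \<and> y = b k)"
    using flip_interlaced[OF k j0 xy] by auto
  have e: "card e = 2" "lo e = x" "hi e = y"
    using less yN by (simp_all add: e_def card_edge lo_edge hi_edge)
  have il: "interlaced e (node j) \<or> interlaced (node j) e" if j: "j < CARD('n)" "j \<noteq> k" for j
    using flip_interlaced[OF k j xy] j by (auto simp: interlaced_def e lo_node hi_node)
  have "e \<noteq> node j" if j: "j < CARD('n)" for j
    using flip_interlaced[OF k j _ xy] nk j e lo_node[of j] hi_node[of j] by (cases "j = k") auto
  then have eE: "e \<notin> E" by (auto simp: E_node)
  have nkE: "node k \<in> E" using kn E_node by auto
  show "E - flipped k = {node k}" using fl eE nkE by auto
  have il': "interlaced e I \<or> interlaced I e" if I: "I \<in> E - {node k}" for I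
  proof -
    obtain j where "j < CARD('n)" "I = node j" using I E_node by auto
    then show ?thesis using il[of j] I by auto
  qed
  have "card (flipped k) = CARD('n)"
    unfolding fl using eE nkE card_E by (simp add: card_Suc_Diff1)
  moreover have "\<forall>I \<in> flipped k. card I = 2"
    using max_thrackle_E e by (auto simp: fl max_thrackle_def)
  moreover have "\<forall>I \<in> flipped k. \<forall>J \<in> flipped k. interlaced I J \<or> interlaced J I"
    using max_thrackle_E il' interlaced_refl[OF e(1)] by (auto simp: fl max_thrackle_def)
  ultimately show "max_thrackle (flipped k)" by (simp add: max_thrackle_def)
qed

text \<open>Flipping is a bijection onto the neighbours: the missing edge recovers \<open>k\<close>,
  and \<open>shared_nodes_flip\<close>, applied to the path of a neighbour, gives
  surjectivity.\<close>

lemma card_neighbours: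
  "card {E'. max_thrackle E' \<and> E' \<noteq> E \<and> card (E \<inter> E') = CARD('n) - 1} = card {k. flippable k}"
proof -
  have inj: "inj_on flipped {k. flippable k}"
  proof (rule inj_onI)
    fix i j assume ij: "i \<in> {k. flippable k}" "j \<in> {k. flippable k}" "flipped i = flipped j"
    then have "node i = node j" using E_minus_flipped[of i] E_minus_flipped[of j] by simp
    moreover have "i < CARD('n)" "j < CARD('n)" using ij by (auto simp: flippable_def corner_def)
    ultimately show "i = j" using inj_on_node by (simp add: inj_on_eq_iff)
  qed
  have "{E'. max_thrackle E' \<and> E' \<noteq> E \<and> card (E \<inter> E') = CARD('n) - 1} = flipped ` {k. flippable k}"
  proof (intro equalityI subsetI)
    fix E' assume "E' \<in> flipped ` {k. flippable k}"
    then obtain k where k: "flippable k" "E' = flipped k" by auto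
    note d = E_minus_flipped[OF k(1), folded k(2)]
    have "card (E - E') = 1" using d by simp
    moreover have "card (E - E') = card E - card (E \<inter> E')" by (simp add: card_Diff_subset_Int)
    moreover have "card (E \<inter> E') \<le> card E" by (simp add: card_mono)
    ultimately have "card (E \<inter> E') = CARD('n) - 1" using card_E by simp
    moreover have "E' \<noteq> E" using d by auto
    ultimately show "E' \<in> {E'. max_thrackle E' \<and> E' \<noteq> E \<and> card (E \<inter> E') = CARD('n) - 1}"
      using max_thrackle_flipped[OF k(1)] k(2) by simp
  next
    fix E' assume "E' \<in> {E'. max_thrackle E' \<and> E' \<noteq> E \<and> card (E \<inter> E') = CARD('n) - 1}"
    then have E': "max_thrackle E'" "card (E \<inter> E') = CARD('n) - 1" by auto
    have "card (E - E') = 1"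
      using E'(2) card_E n3 by (simp add: card_Diff_subset_Int)
    then obtain e where e: "E - E' = {e}" by (auto simp: card_1_singleton_iff)
    then have "e \<in> node ` {..<CARD('n)}" using E_node by blast
    then obtain k where k: "k < CARD('n)" "e = node k" by auto
    obtain m' a' b' where p: "staircase CARD('n) m' a' b'" and E'_eq: "E' = (\<lambda>k. {ix (a' k), ix (b' k)}) ` {..<CARD('n)}"
      using max_thrackle_staircase[OF E'(1) n3] by blast
    interpret p: thrackle_staircase m' a' b' E'
      using p E'_eq E'(1) by (simp add: thrackle_staircase_def thrackle_staircase_axioms_def)
    have other: "\<exists>i<CARD('n). a' i = a j \<and> b' i = b j" if j: "j < CARD('n)" "j \<noteq> k" for j
    proof -
      have "node j \<noteq> node k" using j k inj_on_node by (simp add: inj_on_eq_iff)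
      then have "node j \<in> E'" using e k j E_node by blast
      then obtain i where i: "i < CARD('n)" "node j = p.node i" using p.E_node by auto
      then have "a' i = a j" "b' i = b j"
        using lo_node[OF j(1)] hi_node[OF j(1)] p.lo_node[OF i(1)] p.hi_node[OF i(1)] by auto
      then show ?thesis using i by blast
    qed
    have "\<not> (\<exists>i<CARD('n). a' i = a k \<and> b' i = b k)"
    proof
      assume "\<exists>i<CARD('n). a' i = a k \<and> b' i = b k"
      then obtain i where "i < CARD('n)" "node k = p.node i" by (auto simp: node_def p.node_def)
      then have "node k \<in> E'" unfolding p.E_node by blast
      then show False using e k by auto
    qed
    then have fl: "flippable k" "\<exists>i<CARD('n). (a' i, b' i) = flip k"
      using shared_nodes_flip[OF p k(1) other] by auto
    then obtain i where i: "i < CARD('n)" "flip k = (a' i, b' i)" by auto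
    have "{ix (fst (flip k)), ix (snd (flip k))} \<in> E'" using i by (auto simp: E'_eq)
    then have "flipped k \<subseteq> E'" using e k by (auto simp: flipped_def)
    moreover have "card (flipped k) = card E'"
      using max_thrackle_flipped[OF fl(1)] E'(1) by (simp add: max_thrackle_def)
    ultimately have "flipped k = E'" by (intro card_subset_eq) auto
    then show "E' \<in> flipped ` {k. flippable k}" using fl(1) by blast
  qed
  then show ?thesis using card_image[OF inj] by simp
qed

section \<open>Affine independence, facets and the degree of a simplex\<close>

text \<open>At most \<open>CARD('n)\<close> vectors that span the whole space are independent, so it
  suffices to generate all unit vectors.\<close>

lemma independent_eps: "independent (eps ` E)"
proof -
  define S where "S = span (eps ` E)"
  define ax :: "nat \<Rightarrow> (real, 'n) vec" where "ax x = axis (ix x) 1" for x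
  have eps: "eps (node k) = ax (a k) + ax (b k)" if "k < CARD('n)" for k
  proof -
    have "(ix (a k) :: 'n) \<noteq> ix (b k)"
      using ab_less[OF that] a_less_b[OF that] by (simp add: ix_eq_iff)
    then show ?thesis
      by (auto simp: eps_def ax_def node_def vec_eq_iff axis_def indicator_def)
  qed
  have in_S: "ax (a k) + ax (b k) \<in> S" if "k < CARD('n)" for k
    unfolding S_def E_node eps[OF that, symmetric] using that by (intro span_base imageI) simp
  \<comment> \<open>Consecutive nodes share one coordinate, so subtracting them leaves a difference
    of two unit vectors; these telescope along the path.\<close>
  have diff: "ax (a k) - ax 0 \<in> S \<and> ax (b k) - ax m \<in> S" if "k < CARD('n)" for k
    using that
  proof (induction k)
    case 0
    then show ?case by (simp add: a_first b_first S_def span_zero)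
  next
    case (Suc k)
    have "(ax (a (Suc k)) + ax (b (Suc k))) - (ax (a k) + ax (b k)) \<in> S"
      using in_S[of k] in_S[of "Suc k"] Suc.prems unfolding S_def by (intro span_diff) auto
    then have "ax (a (Suc k)) - ax (a k) \<in> S \<and> ax (b (Suc k)) - ax (b k) \<in> S"
      using step[of k] Suc.prems by (auto simp: S_def span_zero)
    then show ?case
      using Suc span_add[of "ax (a (Suc k)) - ax (a k)" "eps ` E" "ax (a k) - ax 0"]
        span_add[of "ax (b (Suc k)) - ax (b k)" "eps ` E" "ax (b k) - ax m"]
      by (auto simp: S_def)
  qed
  have d: "ax m - ax 0 \<in> S" using diff[of "CARD('n) - Suc 0"] a_last n3 by simp
  have s: "ax 0 + ax m \<in> S" using in_S[of 0] a_first b_first by simp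
  \<comment> \<open>The first node supplies the sum of the unit vectors at \<open>0\<close> and
    \<open>m\<close>, the passage of \<open>a\<close> from \<open>0\<close> to \<open>m\<close>
    their difference.\<close>
  have "(1/2) *\<^sub>R ((ax 0 + ax m) - (ax m - ax 0)) \<in> S"
    using span_scale[OF span_diff[OF s[unfolded S_def] d[unfolded S_def]]] unfolding S_def .
  moreover have "(1/2) *\<^sub>R ((ax 0 + ax m) - (ax m - ax 0)) = ax 0"
    by (simp add: vec_eq_iff)
  ultimately have ax0: "ax 0 \<in> S" by simp
  have axm: "ax m \<in> S" using span_add[of "ax m - ax 0" "eps ` E" "ax 0"] d ax0 by (simp add: S_def)
  have ax: "ax x \<in> S" if x: "x < CARD('n)" for x
  proof -
    obtain k where k: "k < CARD('n)" "x = vertex k" using x vertex_image by blast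
    have "ax (a k) \<in> S" "ax (b k) \<in> S"
      using diff[OF k(1)] span_add[of "ax (a k) - ax 0" "eps ` E" "ax 0"] ax0
        span_add[of "ax (b k) - ax m" "eps ` E" "ax m"] axm by (simp_all add: S_def)
    then show ?thesis using k vertex_in_node[of k] by auto
  qed
  have "Basis \<subseteq> S"
  proof
    fix v :: "(real, 'n) vec" assume "v \<in> Basis"
    then obtain i where "v = axis i 1" by (auto simp: Basis_vec_def)
    then show "v \<in> S" using ax[of "rk i"] rk_less_card[of i] by (simp add: ax_def)
  qed
  then have "span Basis \<subseteq> S" unfolding S_def by (rule span_minimal) simp
  then have "(UNIV :: (real, 'n) vec set) \<subseteq> span (eps ` E)" by (simp add: S_def)
  moreover have "card (eps ` E) \<le> dim (UNIV :: (real, 'n) vec set)"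
    using card_image_le[of E eps] card_E by simp
  ultimately show ?thesis by (intro card_le_dim_spanning[of _ UNIV]) auto
qed

end

lemma inj_eps: "inj (eps :: 'n::finite set \<Rightarrow> real ^ 'n)"
  by (rule injI) (simp add: eps_def vec_eq_iff indicator_def of_bool_eq_iff set_eq_iff)

lemma max_thrackle_staircaseE:
  fixes E :: "'n::{finite,linorder} set set"
  assumes "max_thrackle E" "3 \<le> CARD('n)"
  obtains m a b where "thrackle_staircase m a b E"
proof -
  obtain m a b where "staircase CARD('n) m a b" "E = (\<lambda>k. {ix (a k), ix (b k)}) ` {..<CARD('n)}"
    using max_thrackle_staircase[OF assms] .
  then show thesis
    using that assms(1) by (simp add: thrackle_staircase_def thrackle_staircase_axioms_def)
qed

lemma affine_independent_eps:
  fixes E :: "'n::{finite,linorder} set set"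
  assumes "max_thrackle E" "3 \<le> CARD('n)"
  shows "\<not> affine_dependent (eps ` E)"
proof -
  obtain m a b where "thrackle_staircase m a b E" using max_thrackle_staircaseE[OF assms] .
  then show ?thesis
    using thrackle_staircase.independent_eps affine_dependent_imp_dependent by blast
qed

lemma extreme_points_eps:
  fixes E :: "'n::{finite,linorder} set set"
  assumes "max_thrackle E" "3 \<le> CARD('n)" "T \<subseteq> E"
  shows "{x. x extreme_point_of (convex hull (eps ` T))} = eps ` T"
  using affine_independent_subset[OF affine_independent_eps[OF assms(1,2)] image_mono[OF assms(3)]]
  by (simp add: extreme_point_of_convex_hull_affine_independent)

text \<open>The extreme points recover the edges. Allowing subsets makes this applicable to facets
  as well as to maximal simplices.\<close>

lemma convex_hull_eps_eqD:
  fixes E E' :: "'n::{finite,linorder} set set"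
  assumes "max_thrackle E" "max_thrackle E'" "3 \<le> CARD('n)" "T \<subseteq> E" "T' \<subseteq> E'"
    and "convex hull (eps ` T) = convex hull (eps ` T')"
  shows "T = T'"
proof -
  have "eps ` T = {x. x extreme_point_of (convex hull (eps ` T))}"
    by (rule extreme_points_eps[OF assms(1,3,4), symmetric])
  also have "\<dots> = eps ` T'"
    unfolding assms(6) by (rule extreme_points_eps[OF assms(2,3,5)])
  finally show ?thesis by (simp only: inj_image_eq_iff[OF inj_eps])
qed

lemma Gamma2_maximal_simplices_eq:
  "(Gamma2_maximal_simplices :: (real ^ 'n::{finite,linorder}) set set) =
     (\<lambda>E. convex hull (eps ` E)) ` {E. max_thrackle E}"
  unfolding Gamma2_maximal_simplices_def
  by (auto simp: maximal_sorted_collection_iff_max_thrackle[symmetric])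

text \<open>A facet of a simplex omits exactly one vertex, so a common facet means that dropping one
  edge from each thrackle leaves the same set.\<close>

lemma common_facet_iff:
  fixes E E' :: "'n::{finite,linorder} set set"
  assumes E: "max_thrackle E" "max_thrackle E'" "E \<noteq> E'" and n3: "3 \<le> CARD('n)"
  shows "(\<exists>F. F facet_of (convex hull (eps ` E)) \<and> F facet_of (convex hull (eps ` E'))) \<longleftrightarrow>
    card (E \<inter> E') = CARD('n) - 1"
proof -
  have card: "card E = CARD('n)" "card E' = CARD('n)" using E by (auto simp: max_thrackle_def)
  have facet: "F facet_of (convex hull (eps ` A)) \<longleftrightarrow> F \<noteq> {} \<and> (\<exists>I \<in> A. F = convex hull (eps ` (A - {I})))"
    if A: "max_thrackle A" for A :: "'n set set" and F
  proof -
    have "eps ` A - {eps I} = eps ` (A - {I})" for I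
      using image_set_diff[OF inj_eps, of A "{I}"] by simp
    then show ?thesis
      unfolding facet_of_convex_hull_affine_independent[OF affine_independent_eps[OF A n3]] by auto
  qed
  show ?thesis
  proof
    assume "\<exists>F. F facet_of (convex hull (eps ` E)) \<and> F facet_of (convex hull (eps ` E'))"
    then obtain I I' where I: "I \<in> E" "I' \<in> E'"
      and "convex hull (eps ` (E - {I})) = convex hull (eps ` (E' - {I'}))"
      by (auto simp: facet E)
    then have eq: "E - {I} = E' - {I'}"
      by (intro convex_hull_eps_eqD[OF E(1,2) n3]) auto
    then have "E \<inter> E' = E - {I}" using I E(3) by auto
    then show "card (E \<inter> E') = CARD('n) - 1" using I card by simp
  next
    assume c: "card (E \<inter> E') = CARD('n) - 1"
    have ex: "\<exists>I \<in> A. A \<inter> B = A - {I}"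
      if A: "card A = CARD('n)" "card (A \<inter> B) = CARD('n) - 1" for A B :: "'n set set"
    proof -
      have "card (A - B) = 1" using A n3 by (simp add: card_Diff_subset_Int)
      then obtain I where "A - B = {I}" by (auto simp: card_1_singleton_iff)
      then show ?thesis by (intro bexI[of _ I]) auto
    qed
    let ?F = "convex hull (eps ` (E \<inter> E'))"
    have "E \<inter> E' \<noteq> {}" using c n3 by auto
    then have "?F \<noteq> {}" by simp
    moreover obtain I where "I \<in> E" "E \<inter> E' = E - {I}" using ex[OF card(1) c] by blast
    moreover obtain I' where "I' \<in> E'" "E \<inter> E' = E' - {I'}"
      using ex[OF card(2), of E] c by (auto simp: Int_commute)
    ultimately have "?F facet_of (convex hull (eps ` E))" "?F facet_of (convex hull (eps ` E'))"
      unfolding facet[OF E(1)] facet[OF E(2)] by metis+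
    then show "\<exists>F. F facet_of (convex hull (eps ` E)) \<and> F facet_of (convex hull (eps ` E'))" by blast
  qed
qed

lemma simplex_degree_eq_card_neighbours:
  fixes E :: "'n::{finite,linorder} set set"
  assumes E: "max_thrackle E" and n3: "3 \<le> CARD('n)"
  shows "simplex_degree (convex hull (eps ` E)) =
    card {E'. max_thrackle E' \<and> E' \<noteq> E \<and> card (E \<inter> E') = CARD('n) - 1}"
proof -
  let ?h = "\<lambda>E :: 'n set set. convex hull (eps ` E)"
  let ?N = "{E'. max_thrackle E' \<and> E' \<noteq> E \<and> card (E \<inter> E') = CARD('n) - 1}"
  have inj: "?h A = ?h B \<longleftrightarrow> A = B" if "max_thrackle A" "max_thrackle B" for A B
    using convex_hull_eps_eqD[OF that n3, of A B] by auto
  have "{D' \<in> Gamma2_maximal_simplices. D' \<noteq> ?h E \<and> (\<exists>F. F facet_of ?h E \<and> F facet_of D')} = ?h ` ?N"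
  proof (intro equalityI subsetI)
    fix D' assume "D' \<in> {D' \<in> Gamma2_maximal_simplices. D' \<noteq> ?h E \<and> (\<exists>F. F facet_of ?h E \<and> F facet_of D')}"
    then obtain E' where "max_thrackle E'" "D' = ?h E'" "D' \<noteq> ?h E" "\<exists>F. F facet_of ?h E \<and> F facet_of D'"
      unfolding Gamma2_maximal_simplices_eq by blast
    moreover from this have "E' \<noteq> E" by blast
    ultimately show "D' \<in> ?h ` ?N" using common_facet_iff[OF E _ _ n3, of E'] by blast
  next
    fix D' assume "D' \<in> ?h ` ?N"
    then obtain E' where "max_thrackle E'" "E' \<noteq> E" "card (E \<inter> E') = CARD('n) - 1" "D' = ?h E'" by blast
    then show "D' \<in> {D' \<in> Gamma2_maximal_simplices. D' \<noteq> ?h E \<and> (\<exists>F. F facet_of ?h E \<and> F facet_of D')}"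
      using common_facet_iff[OF E _ _ n3, of E'] inj[OF _ E, of E'] unfolding Gamma2_maximal_simplices_eq by blast
  qed
  moreover have "inj_on ?h ?N" using inj by (intro inj_onI) blast
  ultimately show ?thesis by (simp add: simplex_degree_def card_image)
qed

section \<open>The case of three labels, and the degree formula\<close>

lemma max_thrackle_card_3:
  fixes E :: "'n::{finite,linorder} set set"
  assumes "max_thrackle E" "CARD('n) = 3"
  shows "E = {I. card I = 2}"
proof (rule card_subset_eq)
  show "E \<subseteq> {I. card I = 2}" using assms by (auto simp: max_thrackle_def)
  have "card {I. I \<subseteq> (UNIV :: 'n set) \<and> card I = 2} = 3 choose 2"
    using n_subsets[of "UNIV :: 'n set" 2] assms(2) by simp
  then show "card E = card {I :: 'n set. card I = 2}"
    using assms by (simp add: max_thrackle_def numeral_eq_Suc)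
qed simp

text \<open>A maximal thrackle has as many edges as there are labels, and three labels admit only
  three edges.\<close>

lemma is_triangle_iff_card_3:
  fixes E :: "'n::{finite,linorder} set set"
  assumes E: "max_thrackle E"
  shows "is_triangle E \<longleftrightarrow> CARD('n) = 3"
proof
  assume "is_triangle E"
  then obtain a b c where "a \<noteq> b" "a \<noteq> c" "b \<noteq> c" "E = {{a, b}, {b, c}, {a, c}}"
    by (auto simp: is_triangle_def)
  then have "card E = 3" by (auto simp: doubleton_eq_iff)
  then show "CARD('n) = 3" using E by (simp add: max_thrackle_def)
next
  assume n: "CARD('n) = 3"
  then obtain a b c where abc: "(UNIV :: 'n set) = {a, b, c}" "a \<noteq> b" "a \<noteq> c" "b \<noteq> c"
    by (auto simp: card_3_iff)
  have sub: "{{a, b}, {b, c}, {a, c}} \<subseteq> E"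
    using abc by (auto simp: max_thrackle_card_3[OF E n])
  have "card {{a, b}, {b, c}, {a, c}} = card E"
    using abc(2-4) E n by (auto simp: doubleton_eq_iff max_thrackle_def)
  then have "{{a, b}, {b, c}, {a, c}} = E" using sub by (intro card_subset_eq) auto
  then show "is_triangle E" using abc(2-4) unfolding is_triangle_def by metis
qed

theorem theorem5p6:
  fixes D :: "(real ^ 'n::{finite,linorder}) set"
    and E C :: "'n set set"
  assumes "CARD('n) \<ge> 3"
    and "D \<in> Gamma2_maximal_simplices"
    and "\<forall>I \<in> E. card I = 2"
    and "{x. x extreme_point_of D} = eps ` E"
    and "C = unique_cycle E"
  shows "(is_triangle E \<longrightarrow>
            CARD('n) = 3 \<and> D = hypersimplex2 \<and>
            (Gamma2_maximal_simplices :: (real ^ 'n::{finite,linorder}) set set) = {D} \<and> simplex_degree D = 0) \<and>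
         (\<not> is_triangle E \<and> card C = 3 \<and> card {v. vertex_degree E v = 2} = 2 \<longrightarrow>
            simplex_degree D = 2) \<and>
         (\<not> is_triangle E \<and> \<not> (card C = 3 \<and> card {v. vertex_degree E v = 2} = 2) \<longrightarrow>
            simplex_degree D = card C)"
proof -
  note n3 = assms(1)
  obtain E0 where E0: "max_thrackle E0" "D = convex hull (eps ` E0)"
    using assms(2) unfolding Gamma2_maximal_simplices_eq by blast
  \<comment> \<open>The given edge set is tied to \<open>D\<close> only through the extreme points;
    comparing these shows that it is the thrackle defining \<open>D\<close>.\<close>
  have "eps ` E = eps ` E0"
    unfolding assms(4)[symmetric] E0(2) by (rule extreme_points_eps[OF E0(1) n3 subset_refl])
  then have "E = E0" by (simp only: inj_image_eq_iff[OF inj_eps])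
  with E0 have E: "max_thrackle E" and D: "D = convex hull (eps ` E)" by simp_all
  have deg: "simplex_degree D = card {E'. max_thrackle E' \<and> E' \<noteq> E \<and> card (E \<inter> E') = CARD('n) - 1}"
    unfolding D by (rule simplex_degree_eq_card_neighbours[OF E n3])
  show ?thesis
  proof (cases "CARD('n) = 3")
    case True
    have only: "E' = E" if "max_thrackle E'" for E'
      using max_thrackle_card_3[OF that True] max_thrackle_card_3[OF E True] by simp
    then have G: "(Gamma2_maximal_simplices :: (real, 'n) vec set set) = {D}"
      using E unfolding Gamma2_maximal_simplices_eq D by blast
    have "{E'. max_thrackle E' \<and> E' \<noteq> E \<and> card (E \<inter> E') = CARD('n) - 1} = {}"
      using only by blast
    then have "simplex_degree D = 0" unfolding deg by (simp only: card.empty)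
    moreover have "D = hypersimplex2"
    proof -
      have "eps ` E = {eps I | I. card I = 2}" using max_thrackle_card_3[OF E True] by auto
      then show ?thesis by (simp add: D hypersimplex2_def)
    qed
    ultimately show ?thesis using True G is_triangle_iff_card_3[OF E] by blast
  next
    case False
    then have n4: "4 \<le> CARD('n)" using n3 by simp
    obtain m a b where "thrackle_staircase m a b E" using max_thrackle_staircaseE[OF E n3] .
    then interpret thrackle_staircase m a b E .
    have "simplex_degree D =
        (if card C = 3 \<and> card {v. vertex_degree E v = 2} = 2 then 2 else card C)"
      unfolding deg card_neighbours assms(5) card_unique_cycle card_vertex_degree_2
      by (rule card_flippable[OF n4])
    then show ?thesis using False is_triangle_iff_card_3[OF E] by simp
  qed
qed

end
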